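(* Let $V$ be a finite dimensional vector space over an algebraically closed field $k$ and let $G$ be a finite Abelian subgroup of $GL(V)$ generated by pseudoreflections. Then $S(V^* )^G$ is a polynomial ring if and only if, for every nonzero linear subspace $W\subseteq V$, the pointwise stabilizer of $W$ in $G$ has a polynomial ring of invariants.
   Context: The field $k$ may have any characteristic. $S(V^* )$ is the symmetric algebra of the dual space $V^*$, i.e. the algebra of polynomial functions on $V$. A linear map $g\colon V\to V$ is a pseudoreflection if it has finite order and the set of points fixed by $g$ is a hyperplane. "Polynomial ring (of invariants)" means that the ring is generated as a $k$-algebra by algebraically independent elements. The paper phrases the result as "Kemper-Malle conjecture holds" for such $G$, where this conjecture is: for a finite subgroup $G\subset GL(V)$, $S(V^* )^G$ is polynomial if and only if $G$ is generated by pseudoreflections and the pointwise stabilizer in $G$ of every nonzero subspace of $V$ has a polynomial ring of invariants. *)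

theory Defs
  imports
    "HOL-Computational_Algebra.Polynomial"
    "HOL-Library.Poly_Mapping"
    "HOL-Algebra.Generated_Groups"
begin

text \<open>
  A vector space \<open>V\<close> over \<open>k\<close> is the whole of a type \<open>'v\<close> with a scalar multiplication
  \<open>scale :: 'k \<Rightarrow> 'v \<Rightarrow> 'v\<close>, as in \<^theory>\<open>HOL.Vector_Spaces\<close>.
\<close>

definition GL :: "('k::field \<Rightarrow> 'v::ab_group_add \<Rightarrow> 'v) \<Rightarrow> ('v \<Rightarrow> 'v) monoid" where
  "GL scale = \<lparr>carrier = {g. Vector_Spaces.linear scale scale g \<and> bij g},
     monoid.mult = (\<circ>), one = id\<rparr>"

definition fixed_points :: "('v \<Rightarrow> 'v) \<Rightarrow> 'v set" where
  "fixed_points g = {v. g v = v}"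

definition hyperplane :: "('k::field \<Rightarrow> 'v::ab_group_add \<Rightarrow> 'v) \<Rightarrow> 'v set \<Rightarrow> bool" where
  "hyperplane scale H \<longleftrightarrow>
     module.subspace scale H \<and> vector_space.dim scale H + 1 = vector_space.dim scale UNIV"

definition pseudoreflection :: "('k::field \<Rightarrow> 'v::ab_group_add \<Rightarrow> 'v) \<Rightarrow> ('v \<Rightarrow> 'v) \<Rightarrow> bool" where
  "pseudoreflection scale g \<longleftrightarrow>
     Vector_Spaces.linear scale scale g \<and> (\<exists>n>0. g ^^ n = id) \<and> hyperplane scale (fixed_points g)"

inductive_set generated_algebra :: "('v \<Rightarrow> 'k::comm_ring_1) set \<Rightarrow> ('v \<Rightarrow> 'k) set"
  for B :: "('v \<Rightarrow> 'k) set" where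
  const: "(\<lambda>_. c) \<in> generated_algebra B"
| base: "f \<in> B \<Longrightarrow> f \<in> generated_algebra B"
| add: "f \<in> generated_algebra B \<Longrightarrow> g \<in> generated_algebra B \<Longrightarrow> (\<lambda>v. f v + g v) \<in> generated_algebra B"
| mult: "f \<in> generated_algebra B \<Longrightarrow> g \<in> generated_algebra B \<Longrightarrow> (\<lambda>v. f v * g v) \<in> generated_algebra B"

text \<open>
  \<open>S(V\<^sup>*)\<close> as the algebra of polynomial functions on \<open>V\<close>, generated by the linear forms.
  This is the symmetric algebra of the dual space when \<open>k\<close> is infinite, in particular
  when \<open>k\<close> is algebraically closed.
\<close>

definition polynomial_functions :: "('k::field \<Rightarrow> 'v::ab_group_add \<Rightarrow> 'v) \<Rightarrow> ('v \<Rightarrow> 'k) set" where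
  "polynomial_functions scale = generated_algebra {f. Vector_Spaces.linear scale (*) f}"

text \<open>
  The action is \<open>(g \<cdot> f)(v) = f (g\<^sup>-\<^sup>1 v)\<close>; since \<open>G\<close> is closed under inverses, the
  inverse can be dropped from the invariance condition.
\<close>

definition invariant_ring ::
    "('k::field \<Rightarrow> 'v::ab_group_add \<Rightarrow> 'v) \<Rightarrow> ('v \<Rightarrow> 'v) set \<Rightarrow> ('v \<Rightarrow> 'k) set" where
  "invariant_ring scale G = {f \<in> polynomial_functions scale. \<forall>g\<in>G. \<forall>v. f (g v) = f v}"

text \<open>
  Multivariate polynomials over \<open>'k\<close> with variables indexed by \<open>'i\<close> have type
  \<open>('i \<Rightarrow>\<^sub>0 nat) \<Rightarrow>\<^sub>0 'k\<close>: a finitely supported map from monomials (exponent vectors)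
  to coefficients.
\<close>

definition eval_mpoly :: "('i \<Rightarrow> 'k) \<Rightarrow> (('i \<Rightarrow>\<^sub>0 nat) \<Rightarrow>\<^sub>0 'k::comm_ring_1) \<Rightarrow> 'k" where
  "eval_mpoly x p = (\<Sum>m\<in>Poly_Mapping.keys p. Poly_Mapping.lookup p m * (\<Prod>i\<in>Poly_Mapping.keys m. x i ^ Poly_Mapping.lookup m i))"

text \<open>
  For algebraic independence of a set of functions, the variables of the polynomial are
  indexed by the functions themselves; a polynomial in functions is evaluated pointwise.
\<close>

definition alg_independent :: "('v \<Rightarrow> 'k::comm_ring_1) set \<Rightarrow> bool" where
  "alg_independent B \<longleftrightarrow>
     (\<forall>p :: (('v \<Rightarrow> 'k) \<Rightarrow>\<^sub>0 nat) \<Rightarrow>\<^sub>0 'k.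
        (\<forall>m\<in>Poly_Mapping.keys p. Poly_Mapping.keys m \<subseteq> B) \<longrightarrow> (\<forall>v. eval_mpoly (\<lambda>b. b v) p = 0) \<longrightarrow> p = 0)"

definition polynomial_ring :: "('v \<Rightarrow> 'k::comm_ring_1) set \<Rightarrow> bool" where
  "polynomial_ring R \<longleftrightarrow> (\<exists>B. alg_independent B \<and> generated_algebra B = R)"

definition pointwise_stabilizer :: "('v \<Rightarrow> 'v) set \<Rightarrow> 'v set \<Rightarrow> ('v \<Rightarrow> 'v) set" where
  "pointwise_stabilizer G W = {g \<in> G. \<forall>w\<in>W. g w = w}"

end

theory Submission
  imports Defs "HOL-Library.Function_Algebras"
begin

text \<open>
  Write \<open>k[V]\<close> for the algebra of polynomial functions on \<open>V\<close>.  The two implications have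
  quite different reasons.

  \<^emph>\<open>Polynomial invariants descend to stabilizers.\<close>  A pointwise stabilizer of a subspace is
  reached by fixing the vectors of a basis one after the other, so the case of one vector \<open>v\<close>
  suffices; let \<open>H\<close> be its stabilizer.  Near \<open>v\<close> the quotients by \<open>G\<close> and by \<open>H\<close> look alike:
  an \<open>H\<close>-invariant function, multiplied by an \<open>H\<close>-invariant function that is \<open>1\<close> to high order
  at \<open>v\<close> and \<open>0\<close> to high order at the other points of the orbit, can be summed over its
  \<open>G\<close>-translates, and the resulting \<open>G\<close>-invariant agrees with the given function to high order
  at \<open>v\<close> (\<open>lift_local_invariant\<close>).  Translation by \<open>v\<close> commutes with \<open>H\<close>.  Hence if \<open>k[V]\<^sup>G\<close>
  is generated by \<open>n\<close> algebraically independent functions, their translates are \<open>n\<close> elements of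
  \<open>R = k[V]\<^sup>H\<close> that generate \<open>R\<close> up to terms of arbitrarily high degree.  As \<open>R\<close> is graded, the
  space of its decomposable elements \<open>R\<^sub>+\<^sup>2\<close> has codimension at most \<open>n\<close> in the ideal \<open>R\<^sub>+\<close> of
  elements vanishing at \<open>0\<close>, and by induction on the degree \<open>R\<close> is generated by at most \<open>n\<close>
  homogeneous elements (\<open>graded_algebra_generators\<close>).
  Since \<open>R\<close> contains the \<open>n\<close> independent generators of \<open>k[V]\<^sup>G\<close>, those homogeneous generators
  cannot satisfy a relation: a relation would make the number of monomials of bounded degree grow
  too slowly (\<open>alg_independent_generators\<close>).

  \<^emph>\<open>The converse.\<close>  If \<open>V\<^sup>G \<noteq> 0\<close>, then \<open>G\<close> is itself the pointwise stabilizer of the nonzero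
  subspace \<open>V\<^sup>G\<close>.  If \<open>V\<^sup>G = 0\<close>, write each pseudoreflection of \<open>G\<close> as \<open>v \<mapsto> v + f(v) b\<close>.  That
  two of them commute says \<open>f\<^sub>r(b\<^sub>s) f\<^sub>s(v) b\<^sub>r = f\<^sub>s(b\<^sub>r) f\<^sub>r(v) b\<^sub>s\<close>, so either
  \<open>f\<^sub>s(b\<^sub>r) = 0\<close> or the two hyperplanes coincide; because no nonzero vector is
  fixed by \<open>G\<close>, this excludes transvections and shows that one form for each reflecting hyperplane gives
  a coordinate system in which \<open>G\<close> acts diagonally and every pseudoreflection changes a single
  coordinate.  The invariants are then generated by powers of the coordinates
  (\<open>polynomial_ring_if_no_fixed_vector\<close>).
\<close>

section \<open>Algebras of functions\<close>

lemma infinite_UNIV_alg_closed: "infinite (UNIV :: 'k::alg_closed_field set)"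
proof
  assume fin: "finite (UNIV :: 'k set)"
  define q :: "'k poly" where "q = (\<Prod>a\<in>UNIV. [:- a, 1:])"
  have "degree q = card (UNIV :: 'k set)"
    unfolding q_def by (subst degree_prod_eq_sum_degree) auto
  then have "degree (q + 1) > 0"
    using fin by (subst degree_add_eq_left) (auto simp: card_gt_0_iff)
  then obtain x where "poly (q + 1) x = 0"
    using alg_closed_imp_poly_has_root by blast
  moreover have "poly q x = 0"
    using fin by (auto simp: q_def poly_prod)
  ultimately show False by simp
qed

lemma poly_eqI_infinite:
  fixes p q :: "'k::field poly"
  assumes "infinite (UNIV :: 'k set)" and "\<And>t. poly p t = poly q t"
  shows "p = q"
proof (rule ccontr)
  assume "p \<noteq> q"
  then have "finite {t. poly (p - q) t = 0}"
    by (intro poly_roots_finite) simp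
  with assms show False by simp
qed

lemma sum_fun_apply: "(\<Sum>i\<in>I. f i) v = (\<Sum>i\<in>I. f i v)"
  for f :: "'i \<Rightarrow> 'v \<Rightarrow> 'k::comm_monoid_add"
  by (induction I rule: infinite_finite_induct) auto

lemma prod_fun_apply: "(\<Prod>i\<in>I. f i) v = (\<Prod>i\<in>I. f i v)"
  for f :: "'i \<Rightarrow> 'v \<Rightarrow> 'k::comm_monoid_mult"
  by (induction I rule: infinite_finite_induct) auto

lemma power_fun_apply: "(f ^ n) v = f v ^ n"
  for f :: "'v \<Rightarrow> 'k::monoid_mult"
  by (induction n) auto

text \<open>
  Functions form a commutative ring under pointwise operations. The function space also needs a
  scalar multiplication of its own, in order to speak of spans and linear independence of functions.
\<close>
definition fscale :: "'k \<Rightarrow> ('v \<Rightarrow> 'k) \<Rightarrow> 'v \<Rightarrow> 'k::field" where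
  "fscale c f = (\<lambda>v. c * f v)"

lemma fscale_apply: "fscale c f v = c * f v"
  by (simp add: fscale_def)

text \<open>
  As simplification rules these would also fire on unapplied operators and turn sums and products
  of functions into abstractions, to which the closure lemmas no longer apply.
\<close>
declare plus_fun_apply [simp del] times_fun_apply [simp del] zero_fun_apply [simp del]
  one_fun_apply [simp del] minus_apply [simp del] uminus_apply [simp del]

lemmas pointwise = plus_fun_apply times_fun_apply zero_fun_apply one_fun_apply minus_apply
  uminus_apply fscale_apply sum_fun_apply prod_fun_apply power_fun_apply

lemma generated_algebra_add:
  "f \<in> generated_algebra B \<Longrightarrow> g \<in> generated_algebra B \<Longrightarrow> f + g \<in> generated_algebra B"
  unfolding plus_fun_def by (rule generated_algebra.add)

lemma generated_algebra_times:
  "f \<in> generated_algebra B \<Longrightarrow> g \<in> generated_algebra B \<Longrightarrow> f * g \<in> generated_algebra B"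
  unfolding times_fun_def by (rule generated_algebra.mult)

lemma generated_algebra_zero: "0 \<in> generated_algebra B"
  unfolding zero_fun_def by (rule generated_algebra.const)

lemma generated_algebra_one: "1 \<in> generated_algebra B"
  unfolding one_fun_def by (rule generated_algebra.const)

lemma generated_algebra_scaled:
  "f \<in> generated_algebra B \<Longrightarrow> (\<lambda>v. c * f v) \<in> generated_algebra B"
  by (rule generated_algebra.mult[OF generated_algebra.const])

lemma generated_algebra_diff:
  assumes "f \<in> generated_algebra B" "g \<in> generated_algebra B"
  shows "f - g \<in> generated_algebra B"
proof -
  have "f - g = f + (\<lambda>v. - 1 * g v)" by (auto simp: fun_eq_iff pointwise)
  then show ?thesis
    using assms by (simp only: generated_algebra_add generated_algebra_scaled)
qed

lemma generated_algebra_sum: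
  "(\<And>i. i \<in> I \<Longrightarrow> f i \<in> generated_algebra B) \<Longrightarrow> (\<Sum>i\<in>I. f i) \<in> generated_algebra B"
  by (induction I rule: infinite_finite_induct)
    (auto intro: generated_algebra_add generated_algebra_zero)

lemma generated_algebra_prod:
  "(\<And>i. i \<in> I \<Longrightarrow> f i \<in> generated_algebra B) \<Longrightarrow> (\<Prod>i\<in>I. f i) \<in> generated_algebra B"
  by (induction I rule: infinite_finite_induct)
    (auto intro: generated_algebra_times generated_algebra_one)

lemma generated_algebra_power:
  "f \<in> generated_algebra B \<Longrightarrow> f ^ n \<in> generated_algebra B"
  by (induction n) (auto intro: generated_algebra_times generated_algebra_one)

lemma generated_algebra_subset:
  assumes "B \<subseteq> generated_algebra C"
  shows "generated_algebra B \<subseteq> generated_algebra C"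
proof
  fix f assume "f \<in> generated_algebra B"
  then show "f \<in> generated_algebra C"
    by induction (use assms in \<open>auto intro: generated_algebra.intros\<close>)
qed

interpretation fs: vector_space fscale
  by unfold_locales (auto simp: fun_eq_iff pointwise algebra_simps)

lemma generated_algebra_fscale:
  "f \<in> generated_algebra B \<Longrightarrow> fscale c f \<in> generated_algebra B"
  unfolding fscale_def by (rule generated_algebra_scaled)

lemma generated_algebra_subspace: "fs.subspace (generated_algebra B)"
  by (auto simp: fs.subspace_def generated_algebra_zero generated_algebra_add
      generated_algebra_fscale)

lemma span_times:
  assumes "f \<in> fs.span A" "g \<in> fs.span B"
    and prod: "\<And>a b. a \<in> A \<Longrightarrow> b \<in> B \<Longrightarrow> a * b \<in> fs.span C"
  shows "f * g \<in> fs.span C"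
proof -
  have *: "a * g \<in> fs.span C" if "a \<in> A" for a
    using assms(2)
  proof (induction rule: fs.span_induct_alt)
    case base then show ?case by (simp only: mult_zero_right fs.span_zero)
  next
    case (step c x y)
    have "a * (fscale c x + y) = fscale c (a * x) + a * y"
      by (auto simp: fun_eq_iff pointwise algebra_simps)
    with step prod[OF that] show ?case by (auto intro: fs.span_add fs.span_scale)
  qed
  show ?thesis using assms(1)
  proof (induction rule: fs.span_induct_alt)
    case base then show ?case by (simp only: mult_zero_left fs.span_zero)
  next
    case (step c x y)
    have "(fscale c x + y) * g = fscale c (x * g) + y * g"
      by (auto simp: fun_eq_iff pointwise algebra_simps)
    with step * show ?case by (auto intro: fs.span_add fs.span_scale)
  qed
qed

section \<open>Monomials and algebraic independence\<close>

definition weight :: "('b \<Rightarrow> nat) \<Rightarrow> 'b set \<Rightarrow> ('b \<Rightarrow> nat) \<Rightarrow> nat" where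
  "weight w T a = (\<Sum>t\<in>T. w t * a t)"

text \<open>
  Distinct exponent vectors can be told apart by one weighted degree, as in Kronecker substitution:
  each new variable gets a weight exceeding all earlier weighted degrees, so the exponents are read
  off as digits. This replaces monomial orders: it gives relations a unique leading monomial, with
  induction over natural numbers, and it reduces identities between polynomial
  functions to identities between univariate polynomials.
\<close>
lemma separating_weights:
  fixes A :: "('b \<Rightarrow> nat) set"
  assumes "finite T" "finite A"
  shows "\<exists>w. (\<forall>t. w t \<ge> 1) \<and>
    (\<forall>a\<in>A. \<forall>b\<in>A. weight w T a = weight w T b \<longrightarrow> (\<forall>t\<in>T. a t = b t))"
  using assms(1)
proof (induction T rule: finite_induct)
  case empty
  then show ?case by (intro exI[of _ "\<lambda>_. 1"]) auto
next
  case (insert x T)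
  then obtain w where w: "\<And>t. w t \<ge> (1::nat)"
    "\<And>a b. a \<in> A \<Longrightarrow> b \<in> A \<Longrightarrow> weight w T a = weight w T b \<Longrightarrow> (\<forall>t\<in>T. a t = b t)"
    by blast
  define K where "K = Suc (Max (insert 0 (weight w T ` A)))"
  have K: "weight w T a < K" if "a \<in> A" for a
    using that assms(2) by (auto simp: K_def less_Suc_eq_le)
  define w' where "w' = w(x := K)"
  have w': "weight w' (insert x T) a = weight w T a + K * a x" for a
  proof -
    have "weight w' T a = weight w T a"
      unfolding weight_def using insert.hyps by (intro sum.cong) (auto simp: w'_def)
    then show ?thesis
      using insert.hyps by (simp add: weight_def w'_def)
  qed
  have "\<forall>t\<in>insert x T. a t = b t"
    if "a \<in> A" "b \<in> A" "weight w' (insert x T) a = weight w' (insert x T) b" for a b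
  proof -
    from that have eq: "weight w T a + K * a x = weight w T b + K * b x" by (simp add: w')
    then have "(weight w T a + K * a x) mod K = (weight w T b + K * b x) mod K" by simp
    then have "weight w T a = weight w T b" using K that by simp
    moreover have "K > 0" by (simp add: K_def)
    ultimately have "a x = b x" using eq by simp
    with w(2)[OF that(1,2) \<open>weight w T a = weight w T b\<close>] show ?thesis by auto
  qed
  moreover have "\<forall>t. w' t \<ge> 1" using w(1) by (auto simp: w'_def K_def)
  ultimately show ?case by blast
qed

definition exponents :: "'b set \<Rightarrow> ('b \<Rightarrow> nat) set" where
  "exponents T = {a. \<forall>x. x \<notin> T \<longrightarrow> a x = 0}"

definition power_product :: "('v \<Rightarrow> 'k) set \<Rightarrow> (('v \<Rightarrow> 'k) \<Rightarrow> nat) \<Rightarrow> 'v \<Rightarrow> 'k::field" where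
  "power_product T a = (\<Prod>t\<in>T. t ^ a t)"

lemma power_product_apply: "power_product T a v = (\<Prod>t\<in>T. t v ^ a t)"
  by (simp add: power_product_def prod_fun_apply power_fun_apply)

lemma power_product_add: "power_product T (\<lambda>t. a t + b t) = power_product T a * power_product T b"
  by (auto simp: fun_eq_iff pointwise power_product_apply power_add prod.distrib)

lemma exponents_eqI: "a \<in> exponents T \<Longrightarrow> b \<in> exponents T \<Longrightarrow> (\<And>t. t \<in> T \<Longrightarrow> a t = b t) \<Longrightarrow> a = b"
  by (force simp: exponents_def fun_eq_iff pointwise)

lemma weight_add: "weight w T (\<lambda>t. a t + b t) = weight w T a + weight w T b"
  by (simp add: weight_def algebra_simps sum.distrib)

lemma le_weight:
  assumes "finite T" "w t \<ge> 1" "t \<in> T"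
  shows "a t \<le> weight w T a"
proof -
  have "a t \<le> w t * a t" using assms(2) by simp
  also have "\<dots> \<le> weight w T a"
    unfolding weight_def using assms by (intro member_le_sum) auto
  finally show ?thesis .
qed

text \<open>
  Over a finite set, monomials may be indexed by plain exponent functions rather than by finitely
  supported maps, which makes counting and substituting them easier.
\<close>
lemma alg_independent_iff:
  fixes T :: "('v \<Rightarrow> 'k::field) set"
  assumes "finite T"
  shows "alg_independent T \<longleftrightarrow>
    (\<forall>A c. finite A \<longrightarrow> A \<subseteq> exponents T \<longrightarrow> (\<Sum>a\<in>A. fscale (c a) (power_product T a)) = 0 \<longrightarrow> (\<forall>a\<in>A. c a = 0))"
    (is "_ \<longleftrightarrow> ?R")
proof
  have eval_product: "(\<Prod>i\<in>Poly_Mapping.keys m. i v ^ Poly_Mapping.lookup m i) = power_product T (Poly_Mapping.lookup m) v"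
    if "Poly_Mapping.keys m \<subseteq> T" for m v
    unfolding power_product_apply using that assms
    by (intro prod.mono_neutral_left) (auto simp: not_in_keys_iff_lookup_eq_zero)
  show ?R if ind: "alg_independent T"
  proof (intro allI impI ballI)
    fix A c a0
    assume A: "finite A" "A \<subseteq> exponents T" "(\<Sum>a\<in>A. fscale (c a) (power_product T a)) = 0" "a0 \<in> A"
    define M where "M = (Poly_Mapping.lookup -` A :: (('v \<Rightarrow> 'k) \<Rightarrow>\<^sub>0 nat) set)"
    have finM: "finite M"
      unfolding M_def by (rule finite_vimageI[OF A(1)]) (simp add: inj_on_def lookup_inject)
    define p where "p = Abs_poly_mapping (\<lambda>m. if m \<in> M then c (Poly_Mapping.lookup m) else 0)"
    have p: "Poly_Mapping.lookup p m = (if m \<in> M then c (Poly_Mapping.lookup m) else 0)" for m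
      unfolding p_def using finM by (subst lookup_Abs_poly_mapping) auto
    have keysM: "Poly_Mapping.keys p \<subseteq> M" by (auto simp: in_keys_iff p split: if_splits)
    have keys_le: "Poly_Mapping.keys m \<subseteq> T" if "m \<in> M" for m
      using that A(2) by (force simp: M_def exponents_def in_keys_iff)
    have Abs: "Poly_Mapping.lookup (Abs_poly_mapping a) = a" if "a \<in> A" for a
    proof (rule lookup_Abs_poly_mapping)
      have "{x. a x \<noteq> 0} \<subseteq> T" using that A(2) by (fastforce simp: exponents_def)
      then show "finite {x. a x \<noteq> 0}" using assms by (rule finite_subset)
    qed
    have "eval_mpoly (\<lambda>b. b v) p = 0" for v
    proof -
      have "eval_mpoly (\<lambda>b. b v) p =
        (\<Sum>m\<in>M. Poly_Mapping.lookup p m * (\<Prod>i\<in>Poly_Mapping.keys m. i v ^ Poly_Mapping.lookup m i))"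
        unfolding eval_mpoly_def using finM keysM
        by (intro sum.mono_neutral_left) (auto simp: in_keys_iff)
      also have "\<dots> = (\<Sum>m\<in>M. c (Poly_Mapping.lookup m) * power_product T (Poly_Mapping.lookup m) v)"
        using keys_le eval_product by (intro sum.cong) (auto simp: p)
      also have "\<dots> = (\<Sum>a\<in>A. c a * power_product T a v)"
        by (rule sum.reindex_bij_witness[of _ Abs_poly_mapping Poly_Mapping.lookup])
          (auto simp: M_def Abs lookup_inverse)
      also have "\<dots> = (\<Sum>a\<in>A. fscale (c a) (power_product T a)) v" by (simp add: pointwise)
      finally show ?thesis using A(3) by (simp add: pointwise)
    qed
    moreover have "\<forall>m\<in>Poly_Mapping.keys p. Poly_Mapping.keys m \<subseteq> T" using keysM keys_le by blast
    ultimately have "p = 0" using ind by (simp add: alg_independent_def)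
    then have "Poly_Mapping.lookup p (Abs_poly_mapping a0) = 0" by simp
    then show "c a0 = 0" using A(4) by (simp add: p M_def Abs)
  qed
  show "alg_independent T" if R: ?R
    unfolding alg_independent_def
  proof (intro allI impI)
    fix p :: "(('v \<Rightarrow> 'k) \<Rightarrow>\<^sub>0 nat) \<Rightarrow>\<^sub>0 'k"
    assume p: "\<forall>m\<in>Poly_Mapping.keys p. Poly_Mapping.keys m \<subseteq> T" "\<forall>v. eval_mpoly (\<lambda>b. b v) p = 0"
    define c where "c a = Poly_Mapping.lookup p (Abs_poly_mapping a)" for a
    have inj: "inj_on Poly_Mapping.lookup (Poly_Mapping.keys p)" by (simp add: inj_on_def lookup_inject)
    have "(\<Sum>a\<in>Poly_Mapping.lookup ` Poly_Mapping.keys p. fscale (c a) (power_product T a)) v = 0" for v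
    proof -
      have "(\<Sum>a\<in>Poly_Mapping.lookup ` Poly_Mapping.keys p. fscale (c a) (power_product T a)) v =
        (\<Sum>m\<in>Poly_Mapping.keys p. Poly_Mapping.lookup p m * power_product T (Poly_Mapping.lookup m) v)"
        by (simp add: pointwise sum.reindex[OF inj] c_def lookup_inverse)
      also have "\<dots> = eval_mpoly (\<lambda>b. b v) p"
        unfolding eval_mpoly_def using p(1) eval_product by (intro sum.cong) auto
      finally show ?thesis using p(2) by simp
    qed
    then have "(\<Sum>a\<in>Poly_Mapping.lookup ` Poly_Mapping.keys p. fscale (c a) (power_product T a)) = 0" by (simp add: fun_eq_iff pointwise)
    moreover have "Poly_Mapping.lookup ` Poly_Mapping.keys p \<subseteq> exponents T"
      using p(1) by (force simp: exponents_def in_keys_iff)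
    ultimately have "\<forall>a\<in>Poly_Mapping.lookup ` Poly_Mapping.keys p. c a = 0"
      using R[rule_format, of "Poly_Mapping.lookup ` Poly_Mapping.keys p" c] by simp
    then have "\<forall>m\<in>Poly_Mapping.keys p. Poly_Mapping.lookup p m = 0" by (simp add: c_def lookup_inverse)
    then show "p = 0" by (metis in_keys_iff poly_mapping_eqI lookup_zero)
  qed
qed

lemma alg_independent_subset:
  "alg_independent B \<Longrightarrow> F \<subseteq> B \<Longrightarrow> alg_independent F"
  unfolding alg_independent_def by blast

lemma not_alg_independent_zero:
  fixes T :: "('v \<Rightarrow> 'k::field) set"
  assumes "finite T" "0 \<in> T"
  shows "\<not> alg_independent T"
proof
  assume ind: "alg_independent T"
  define a :: "('v \<Rightarrow> 'k) \<Rightarrow> nat" where "a = (\<lambda>t. if t = 0 then 1 else 0)"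
  have "power_product T a v = 0" for v
    unfolding power_product_apply using assms by (intro prod_zero) (auto simp: a_def pointwise intro!: bexI[of _ 0])
  then have "(\<Sum>a\<in>{a}. fscale 1 (power_product T a)) = 0" by (auto simp: fun_eq_iff pointwise)
  moreover have "{a} \<subseteq> exponents T" using assms by (auto simp: a_def exponents_def)
  ultimately have "\<forall>a\<in>{a}. (1::'k) = 0"
    using ind[unfolded alg_independent_iff[OF assms(1)], rule_format, of "{a}" "\<lambda>_. 1"] by simp
  then show False by simp
qed

section \<open>Counting monomials\<close>

definition bounded_monomials where
  "bounded_monomials w T E = power_product T ` {a \<in> exponents T. weight w T a \<le> E}"

lemma bounded_monomials_mono:
  "E \<le> E' \<Longrightarrow> bounded_monomials w T E \<subseteq> bounded_monomials w T E'"
  by (auto simp: bounded_monomials_def)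

lemma bounded_monomials_times:
  assumes "f \<in> fs.span (bounded_monomials w T E)" "g \<in> fs.span (bounded_monomials w T E')"
  shows "f * g \<in> fs.span (bounded_monomials w T (E + E'))"
proof (rule span_times[OF assms])
  fix x y assume "x \<in> bounded_monomials w T E" "y \<in> bounded_monomials w T E'"
  then obtain a b where ab: "x = power_product T a" "a \<in> exponents T" "weight w T a \<le> E"
      "y = power_product T b" "b \<in> exponents T" "weight w T b \<le> E'"
    unfolding bounded_monomials_def by blast
  then have "x * y = power_product T (\<lambda>t. a t + b t)" "(\<lambda>t. a t + b t) \<in> exponents T"
    "weight w T (\<lambda>t. a t + b t) \<le> E + E'"
    by (auto simp: power_product_add exponents_def weight_add)
  then show "x * y \<in> fs.span (bounded_monomials w T (E + E'))"
    unfolding bounded_monomials_def by (intro fs.span_base) blast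
qed

lemma one_in_bounded_monomials: "1 \<in> fs.span (bounded_monomials w T E)"
proof -
  have "power_product T (\<lambda>_. 0) = 1" by (auto simp: fun_eq_iff pointwise power_product_apply)
  then show ?thesis unfolding bounded_monomials_def
    by (intro fs.span_base image_eqI[of _ _ "\<lambda>_. 0"]) (auto simp: exponents_def weight_def)
qed

text \<open>
  The weighted degree exhausts the generated algebra by finite-dimensional spaces.
\<close>
lemma generated_algebra_bounded:
  assumes "finite T" "f \<in> generated_algebra T"
  shows "\<exists>E. f \<in> fs.span (bounded_monomials w T E)"
  using assms(2)
proof induction
  case (const c)
  have "(\<lambda>_. c) = fscale c 1" by (auto simp: fun_eq_iff pointwise)
  then show ?case using one_in_bounded_monomials fs.span_scale by metis
next
  case (base f)
  let ?a = "\<lambda>t. if t = f then 1 else 0 :: nat"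
  have "power_product T ?a v = f v" for v
  proof -
    have "power_product T ?a v = (\<Prod>t\<in>T. if t = f then f v else 1)"
      unfolding power_product_apply by (intro prod.cong) auto
    also have "\<dots> = f v" using assms(1) base by simp
    finally show ?thesis .
  qed
  then have "f = power_product T ?a" by auto
  moreover have "?a \<in> exponents T" using base by (auto simp: exponents_def)
  ultimately have "f \<in> bounded_monomials w T (weight w T ?a)"
    unfolding bounded_monomials_def by blast
  then show ?case using fs.span_base by blast
next
  case (add f g)
  then obtain E E' where "f \<in> fs.span (bounded_monomials w T E)"
    "g \<in> fs.span (bounded_monomials w T E')" by blast
  then have "f \<in> fs.span (bounded_monomials w T (max E E'))"
    "g \<in> fs.span (bounded_monomials w T (max E E'))"
    using fs.span_mono[OF bounded_monomials_mono] by (metis in_mono max.cobounded1 max.cobounded2)+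
  then have "f + g \<in> fs.span (bounded_monomials w T (max E E'))" by (rule fs.span_add)
  then show ?case unfolding plus_fun_def by blast
next
  case (mult f g)
  then show ?case using bounded_monomials_times unfolding times_fun_def by blast
qed

text \<open>
  Setting the values off \<open>T\<close> to \<open>undefined\<close> instead of \<open>0\<close> identifies the box with an extensional
  product of intervals.
\<close>
lemma card_exponents_box:
  assumes "finite T"
  shows "finite {a \<in> exponents T. \<forall>t\<in>T. a t < u t}"
    and "card {a \<in> exponents T. \<forall>t\<in>T. a t < u t} = (\<Prod>t\<in>T. u t)"
proof -
  have bij: "bij_betw (\<lambda>a. restrict a T) {a \<in> exponents T. \<forall>t\<in>T. a t < u t} (PiE T (\<lambda>t. {..<u t}))"
    by (rule bij_betw_byWitness[of _ "\<lambda>c x. if x \<in> T then c x else 0"])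
      (auto simp: exponents_def fun_eq_iff pointwise PiE_def extensional_def)
  then show "finite {a \<in> exponents T. \<forall>t\<in>T. a t < u t}"
    using assms by (subst bij_betw_finite[OF bij]) (auto intro: finite_PiE)
  show "card {a \<in> exponents T. \<forall>t\<in>T. a t < u t} = (\<Prod>t\<in>T. u t)"
    using assms by (simp add: bij_betw_same_card[OF bij] card_PiE)
qed

text \<open>
  A relation, solved for its leading monomial \<open>\<mu>\<close>, expresses \<open>\<mu>\<close> by monomials of smaller weight.
  Multiplied by arbitrary monomials it rewrites, by induction on the weight, everything into
  monomials that are not divisible by \<open>\<mu>\<close>.
\<close>
lemma relation_reduces_monomials:
  fixes T :: "('v \<Rightarrow> 'k::field) set"
  assumes T: "finite T" and dep: "\<not> alg_independent T"
  shows "\<exists>w \<mu>. (\<forall>t. w t \<ge> (1::nat)) \<and> \<mu> \<in> exponents T \<and> (\<forall>E. bounded_monomials w T E \<subseteq>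
    fs.span (power_product T ` {a \<in> exponents T. weight w T a \<le> E \<and> \<not> (\<forall>t\<in>T. \<mu> t \<le> a t)}))"
proof -
  obtain A c a1 where A: "finite A" "A \<subseteq> exponents T" "(\<Sum>a\<in>A. fscale (c a) (power_product T a)) = 0"
    "a1 \<in> A" "c a1 \<noteq> (0::'k)"
    using dep unfolding alg_independent_iff[OF T] by blast
  define A' where "A' = {a \<in> A. c a \<noteq> 0}"
  have A': "finite A'" "A' \<subseteq> exponents T" "A' \<noteq> {}" using A by (auto simp: A'_def)
  have sum: "(\<Sum>a\<in>A'. fscale (c a) (power_product T a)) = 0"
    unfolding A(3)[symmetric] A'_def using A(1)
    by (intro sum.mono_neutral_left) (auto simp: fun_eq_iff pointwise)
  obtain w where w: "\<And>t. w t \<ge> (1::nat)"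
    "\<And>a b. a \<in> A' \<Longrightarrow> b \<in> A' \<Longrightarrow> weight w T a = weight w T b \<Longrightarrow> (\<forall>t\<in>T. a t = b t)"
    using separating_weights[OF T A'(1)] by blast
  obtain \<mu> where \<mu>: "\<mu> \<in> A'" "\<And>a. a \<in> A' \<Longrightarrow> weight w T a \<le> weight w T \<mu>"
  proof -
    have "Max (weight w T ` A') \<in> weight w T ` A'" using A'(1,3) by (intro Max_in) auto
    then obtain \<nu> where "\<nu> \<in> A'" "Max (weight w T ` A') = weight w T \<nu>" by blast
    then show ?thesis using that[of \<nu>] A'(1) by (metis Max_ge finite_imageI imageI)
  qed
  have weight_less: "weight w T a < weight w T \<mu>" if "a \<in> A' - {\<mu>}" for a
  proof -
    have "weight w T a \<noteq> weight w T \<mu>"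
      using w(2)[of a \<mu>] exponents_eqI[of a T \<mu>] that \<mu>(1) A'(2) by blast
    with \<mu>(2)[of a] that show ?thesis by simp
  qed
  have c\<mu>: "c \<mu> \<noteq> 0" using \<mu>(1) by (simp add: A'_def)
  define d where "d a = - c a / c \<mu>" for a
  have leading: "power_product T \<mu> = (\<Sum>a\<in>A'-{\<mu>}. fscale (d a) (power_product T a))"
  proof
    fix v
    have "c \<mu> * power_product T \<mu> v + (\<Sum>a\<in>A'-{\<mu>}. c a * power_product T a v) = (\<Sum>a\<in>A'. c a * power_product T a v)"
      using sum.remove[OF A'(1) \<mu>(1), of "\<lambda>a. c a * power_product T a v"] by simp
    also have "\<dots> = 0" using fun_cong[OF sum, of v] by (simp add: pointwise)
    finally have "power_product T \<mu> v = - (\<Sum>a\<in>A'-{\<mu>}. c a * power_product T a v) / c \<mu>"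
      using c\<mu> by (simp add: field_simps add_eq_0_iff)
    then show "power_product T \<mu> v = (\<Sum>a\<in>A'-{\<mu>}. fscale (d a) (power_product T a)) v"
      by (simp add: pointwise d_def sum_divide_distrib sum_negf)
  qed
  define R where "R E = power_product T ` {a \<in> exponents T. weight w T a \<le> E \<and> \<not> (\<forall>t\<in>T. \<mu> t \<le> a t)}" for E
  have R_mono: "R E \<subseteq> R E'" if "E \<le> E'" for E E' using that by (auto simp: R_def)
  have red: "power_product T a \<in> fs.span (R (weight w T a))" if "a \<in> exponents T" for a
    using that
  proof (induction "weight w T a" arbitrary: a rule: less_induct)
    case less
    show ?case
    proof (cases "\<forall>t\<in>T. \<mu> t \<le> a t")
      case False
      then have "power_product T a \<in> R (weight w T a)" using less.prems unfolding R_def by blast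
      then show ?thesis by (rule fs.span_base)
    next
      case True
      define r where "r = (\<lambda>t. a t - \<mu> t)"
      have \<mu>e: "\<mu> \<in> exponents T" using \<mu>(1) A'(2) by blast
      have a: "a = (\<lambda>t. r t + \<mu> t)"
      proof
        fix t show "a t = r t + \<mu> t"
          using True \<mu>e less.prems by (cases "t \<in> T") (auto simp: r_def exponents_def)
      qed
      have "power_product T a = power_product T r * power_product T \<mu>"
        by (subst a) (rule power_product_add)
      also have "\<dots> = (\<Sum>b\<in>A'-{\<mu>}. fscale (d b) (power_product T (\<lambda>t. r t + b t)))"
        unfolding leading power_product_add
        by (auto simp: fun_eq_iff pointwise sum_distrib_left algebra_simps)
      also have "\<dots> \<in> fs.span (R (weight w T a))"
      proof (intro fs.span_sum fs.span_scale)
        fix b assume b: "b \<in> A' - {\<mu>}"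
        have "weight w T a = weight w T r + weight w T \<mu>"
          by (subst a) (rule weight_add)
        then have lt: "weight w T (\<lambda>t. r t + b t) < weight w T a"
          using weight_less[OF b] by (simp add: weight_add)
        moreover have "(\<lambda>t. r t + b t) \<in> exponents T"
          using b A'(2) less.prems by (auto simp: exponents_def r_def)
        ultimately have "power_product T (\<lambda>t. r t + b t) \<in> fs.span (R (weight w T (\<lambda>t. r t + b t)))"
          using less.hyps by blast
        then show "power_product T (\<lambda>t. r t + b t) \<in> fs.span (R (weight w T a))"
          using fs.span_mono[OF R_mono] lt by (meson in_mono less_imp_le)
      qed
      finally show ?thesis .
    qed
  qed
  have "bounded_monomials w T E \<subseteq> fs.span (R E)" for E
  proof
    fix x assume "x \<in> bounded_monomials w T E"
    then obtain a where "x = power_product T a" "a \<in> exponents T" "weight w T a \<le> E"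
      unfolding bounded_monomials_def by blast
    then show "x \<in> fs.span (R E)" using red fs.span_mono[OF R_mono] by blast
  qed
  then show ?thesis using w(1) \<mu>(1) A'(2) unfolding R_def by blast
qed

text \<open>
  Put \<open>m = card T\<close> and \<open>n = card F\<close>. The \<open>(D + 1)\<^sup>n\<close> monomials in \<open>F\<close> with exponents at most \<open>D\<close>
  are linearly independent and lie among polynomials in \<open>T\<close> of degree \<open>O(D)\<close>. If \<open>T\<close> satisfied a
  relation with leading monomial \<open>\<mu>\<close>, these would be spanned by monomials not divisible by \<open>\<mu>\<close>.
  Such a monomial has some exponent below that of \<open>\<mu>\<close>, so there are only \<open>O(D\<^sup>m\<^sup>-\<^sup>1)\<close> of them, which
  is too few when \<open>m \<le> n\<close>.
\<close>
lemma alg_independent_generators: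
  fixes T F :: "('v \<Rightarrow> 'k::field) set"
  assumes T: "finite T" and F: "finite F" "alg_independent F"
    and sub: "F \<subseteq> generated_algebra T" and card: "card T \<le> card F"
  shows "alg_independent T"
proof (rule ccontr)
  assume "\<not> alg_independent T"
  then obtain w \<mu> where w: "\<And>t. w t \<ge> (1::nat)" and \<mu>: "\<mu> \<in> exponents T"
    and red: "\<And>E. bounded_monomials w T E \<subseteq>
      fs.span (power_product T ` {a \<in> exponents T. weight w T a \<le> E \<and> \<not> (\<forall>t\<in>T. \<mu> t \<le> a t)})"
    using relation_reduces_monomials[OF T] by blast
  define R where "R E = {a \<in> exponents T. weight w T a \<le> E \<and> \<not> (\<forall>t\<in>T. \<mu> t \<le> a t)}" for E
  define m where "m = card T"
  define K where "K = (\<Sum>t\<in>T. \<mu> t)"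
  have cardR: "finite (R E) \<and> card (R E) \<le> K * Suc E ^ (m - 1)" for E
  proof -
    \<comment> \<open>The set \<open>S t\<close> collects the monomials in which the exponent of \<open>t\<close> keeps \<open>\<mu>\<close> from dividing.\<close>
    define S where "S t = {a \<in> exponents T. \<forall>s\<in>T. a s < (if s = t then \<mu> t else Suc E)}" for t
    have S: "finite (S t)" for t unfolding S_def by (rule card_exponents_box[OF T])
    have cS: "card (S t) = \<mu> t * Suc E ^ (m - 1)" if "t \<in> T" for t
    proof -
      have "card (S t) = (\<Prod>s\<in>T. if s = t then \<mu> t else Suc E)"
        unfolding S_def by (rule card_exponents_box[OF T])
      also have "\<dots> = \<mu> t * (\<Prod>s\<in>T-{t}. if s = t then \<mu> t else Suc E)"
        using prod.remove[OF T that, of "\<lambda>s. if s = t then \<mu> t else Suc E"] by simp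
      also have "(\<Prod>s\<in>T-{t}. if s = t then \<mu> t else Suc E) = (\<Prod>s\<in>T-{t}. Suc E)"
        by (intro prod.cong) auto
      finally show ?thesis using that T by (simp add: m_def)
    qed
    have sub: "R E \<subseteq> (\<Union>t\<in>T. S t)"
    proof
      fix a assume a: "a \<in> R E"
      then obtain t where "t \<in> T" "a t < \<mu> t" by (auto simp: R_def not_le)
      moreover have "a s < Suc E" if "s \<in> T" for s
        using le_weight[of T w s a] T w that a by (simp add: R_def)
      ultimately show "a \<in> (\<Union>t\<in>T. S t)" using a by (auto simp: S_def R_def)
    qed
    have "card (R E) \<le> card (\<Union>t\<in>T. S t)" using sub S T by (intro card_mono) auto
    also have "\<dots> \<le> (\<Sum>t\<in>T. card (S t))" using T by (rule card_UN_le)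
    also have "\<dots> = K * Suc E ^ (m - 1)" by (simp add: cS K_def sum_distrib_right)
    finally show ?thesis using sub S T by (meson finite_UN_I finite_subset)
  qed
  have "\<exists>e. \<forall>f\<in>F. f \<in> fs.span (bounded_monomials w T e)"
  proof -
    have "\<forall>f\<in>F. \<exists>e. f \<in> fs.span (bounded_monomials w T e)"
      using generated_algebra_bounded[OF T] sub by blast
    then obtain e where e: "\<forall>f\<in>F. f \<in> fs.span (bounded_monomials w T (e f))" by metis
    have "f \<in> fs.span (bounded_monomials w T (\<Sum>f\<in>F. e f))" if "f \<in> F" for f
    proof -
      have "e f \<le> (\<Sum>f\<in>F. e f)" using F(1) that by (intro member_le_sum) auto
      then show ?thesis using e that fs.span_mono[OF bounded_monomials_mono] by blast
    qed
    then show ?thesis by blast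
  qed
  then obtain e where e: "\<And>f. f \<in> F \<Longrightarrow> f \<in> fs.span (bounded_monomials w T e)" by blast
  define n where "n = card F"
  have bound: "Suc D ^ n \<le> K * Suc (e * n * D) ^ (m - 1)" for D
  proof -
    define X where "X = {b \<in> exponents F. \<forall>f\<in>F. b f < Suc D}"
    have X: "finite X" "card X = Suc D ^ n"
      using card_exponents_box[OF F(1), of "\<lambda>_. Suc D"] by (simp_all add: X_def n_def)
    have ind: "\<forall>a\<in>A. c a = 0" if "finite A" "A \<subseteq> X" "(\<Sum>a\<in>A. fscale (c a) (power_product F a)) = 0" for A c
    proof -
      have "A \<subseteq> exponents F" using that(2) by (auto simp: X_def)
      then show ?thesis
        using F(2)[unfolded alg_independent_iff[OF F(1)]] that by blast
    qed
    have inj: "inj_on (power_product F) X"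
    proof (rule inj_onI, rule ccontr)
      fix a b assume ab: "a \<in> X" "b \<in> X" "power_product F a = power_product F b" "a \<noteq> b"
      then have "(\<Sum>x\<in>{a,b}. fscale (if x = a then 1 else - 1) (power_product F x)) = 0"
        by (auto simp: fun_eq_iff pointwise)
      then have "(1::'k) = 0" using ind[of "{a,b}" "\<lambda>x. if x = a then 1 else - 1"] ab by auto
      then show False by simp
    qed
    have "fs.independent (power_product F ` X)"
    proof (rule fs.independent_if_scalars_zero)
      fix c x assume c: "(\<Sum>x\<in>power_product F ` X. fscale (c x) x) = 0" and x: "x \<in> power_product F ` X"
      have "(\<Sum>a\<in>X. fscale (c (power_product F a)) (power_product F a)) = 0"
        using c by (simp add: sum.reindex[OF inj])
      then show "c x = 0" using ind[of X "\<lambda>a. c (power_product F a)"] X x by auto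
    qed (use X in simp)
    moreover have "power_product F ` X \<subseteq> fs.span (power_product T ` R (e * n * D))"
    proof
      fix x assume "x \<in> power_product F ` X"
      then obtain b where b: "x = power_product F b" "\<And>f. f \<in> F \<Longrightarrow> b f \<le> D" by (fastforce simp: X_def less_Suc_eq_le)
      have pow: "f ^ j \<in> fs.span (bounded_monomials w T (e * j))" if "f \<in> F" for f j
      proof (induction j)
        case 0 then show ?case by (simp add: one_in_bounded_monomials)
      next
        case (Suc j)
        show ?case using bounded_monomials_times[OF e[OF that] Suc] by simp
      qed
      have "(\<Prod>f\<in>F'. f ^ b f) \<in> fs.span (bounded_monomials w T (e * (\<Sum>f\<in>F'. b f)))"
        if "F' \<subseteq> F" for F'
        using finite_subset[OF that F(1)] that
      proof (induction F' rule: finite_induct)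
        case empty then show ?case by (simp add: one_in_bounded_monomials)
      next
        case (insert f F')
        then show ?case
          by (simp add: bounded_monomials_times pow distrib_left)
      qed
      then have "x \<in> fs.span (bounded_monomials w T (e * (\<Sum>f\<in>F. b f)))"
        by (simp add: b power_product_def)
      moreover have "e * (\<Sum>f\<in>F. b f) \<le> e * n * D"
      proof -
        have "(\<Sum>f\<in>F. b f) \<le> n * D" using sum_bounded_above[of F b D] b(2) by (simp add: n_def)
        then show ?thesis by (simp add: mult.assoc)
      qed
      ultimately have "x \<in> fs.span (bounded_monomials w T (e * n * D))"
        using fs.span_mono[OF bounded_monomials_mono] by blast
      then show "x \<in> fs.span (power_product T ` R (e * n * D))"
        using fs.span_minimal[OF red fs.subspace_span] unfolding R_def by blast
    qed
    ultimately have "card (power_product F ` X) \<le> card (power_product T ` R (e * n * D))"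
      using fs.independent_span_bound cardR by blast
    also have "\<dots> \<le> card (R (e * n * D))" using cardR by (intro card_image_le) blast
    also have "\<dots> \<le> K * Suc (e * n * D) ^ (m - 1)" using cardR by blast
    finally show ?thesis using X inj by (simp add: card_image)
  qed
  \<comment> \<open>For \<open>K = 0\<close> the bound would say \<open>1 \<le> 0\<close>; this also covers an empty \<open>T\<close>, so that \<open>m - 1\<close> is
    a genuine difference below.\<close>
  have "K > 0" using bound[of 0] by (cases "K = 0") auto
  then have "m > 0" unfolding K_def m_def using T by (cases "T = {}") (auto simp: card_gt_0_iff)
  define D where "D = K * Suc (e * n) ^ (m - 1)"
  have "Suc D ^ m \<le> Suc D ^ n" using card by (intro power_increasing) (auto simp: m_def n_def)
  also have "\<dots> \<le> K * Suc (e * n * D) ^ (m - 1)" by (rule bound)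
  also have "\<dots> \<le> K * (Suc (e * n) * Suc D) ^ (m - 1)"
    by (intro mult_le_mono2 power_mono) auto
  also have "\<dots> = D * Suc D ^ (m - 1)"
    unfolding power_mult_distrib by (simp only: D_def mult.assoc)
  finally have "Suc D * Suc D ^ (m - 1) \<le> D * Suc D ^ (m - 1)"
    using \<open>m > 0\<close> by (simp add: power_eq_if)
  then show False by simp
qed

text \<open>
  Were \<open>B\<close> infinite, it would contain as many functions as \<open>X\<close> together with the redundant
  generator \<open>0\<close>. The previous lemma would then make that enlarged generating set independent,
  although it contains \<open>0\<close>.
\<close>
lemma alg_independent_finite:
  fixes B X :: "('v \<Rightarrow> 'k::field) set"
  assumes "finite X" "alg_independent B" "B \<subseteq> generated_algebra X"
  shows "finite B"
proof (rule ccontr)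
  assume "infinite B"
  then obtain F where F: "F \<subseteq> B" "finite F" "card F = card (insert 0 X)"
    using infinite_arbitrarily_large by blast
  have "generated_algebra X \<subseteq> generated_algebra (insert 0 X)"
    by (rule generated_algebra_subset) (auto intro: generated_algebra.base)
  then have "alg_independent (insert 0 X)"
    using F assms alg_independent_subset
    by (intro alg_independent_generators[of "insert 0 X" F]) auto
  then show False using not_alg_independent_zero[of "insert 0 X"] assms(1) by simp
qed

text \<open>
  If the functions in \<open>B\<close> take all tuples of values, substituting \<open>t\<close> to separating powers turns a
  relation into a univariate polynomial that vanishes on an infinite field; distinct monomials
  contribute distinct powers of \<open>t\<close>.
\<close>
lemma alg_independent_if_surjective:
  fixes B :: "('v \<Rightarrow> 'k::field) set"
  assumes inf: "infinite (UNIV :: 'k set)" and B: "finite B"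
    and surj: "\<And>x :: ('v \<Rightarrow> 'k) \<Rightarrow> 'k. \<exists>v. \<forall>b\<in>B. b v = x b"
  shows "alg_independent B"
  unfolding alg_independent_iff[OF B]
proof (intro allI impI ballI)
  fix A c a0
  assume A: "finite A" "A \<subseteq> exponents B" "(\<Sum>a\<in>A. fscale (c a) (power_product B a)) = 0" "a0 \<in> A"
  obtain w where w: "\<And>a b. a \<in> A \<Longrightarrow> b \<in> A \<Longrightarrow> weight w B a = weight w B b \<Longrightarrow> \<forall>t\<in>B. a t = b t"
    using separating_weights[OF B A(1)] by blast
  have inj: "a = b" if "a \<in> A" "b \<in> A" "weight w B a = weight w B b" for a b
    using w[OF that] A(2) that by (intro exponents_eqI[of a B b]) auto
  have "poly (\<Sum>a\<in>A. monom (c a) (weight w B a)) t = poly 0 t" for t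
  proof -
    obtain v where v: "\<And>b. b \<in> B \<Longrightarrow> b v = t ^ w b" using surj[of "\<lambda>b. t ^ w b"] by blast
    have "power_product B a v = t ^ weight w B a" for a
      by (simp add: power_product_apply v weight_def power_sum power_mult)
    then have "(\<Sum>a\<in>A. c a * t ^ weight w B a) = (\<Sum>a\<in>A. fscale (c a) (power_product B a)) v"
      by (simp add: pointwise)
    then show ?thesis using A(3) by (simp add: poly_sum poly_monom pointwise)
  qed
  then have "(\<Sum>a\<in>A. monom (c a) (weight w B a)) = 0" by (rule poly_eqI_infinite[OF inf])
  then have "coeff (\<Sum>a\<in>A. monom (c a) (weight w B a)) (weight w B a0) = 0" by simp
  moreover have "coeff (\<Sum>a\<in>A. monom (c a) (weight w B a)) (weight w B a0) =
    (\<Sum>a\<in>A. if a = a0 then c a0 else 0)"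
    unfolding coeff_sum using inj A(4) by (intro sum.cong) auto
  ultimately show "c a0 = 0" using A(1,4) by simp
qed

section \<open>The grading of polynomial functions\<close>

text \<open>
  Over an infinite field a polynomial is determined by its values, so homogeneous components of a
  polynomial function can be read off from its restrictions to lines through the origin.
\<close>
locale infinite_field_vector_space = finite_dimensional_vector_space scale Basis
  for scale :: "'k::field \<Rightarrow> 'v::ab_group_add \<Rightarrow> 'v" and Basis :: "'v set" +
  assumes infinite_scalars: "infinite (UNIV :: 'k set)"
begin

abbreviation PF :: "('v \<Rightarrow> 'k) set" where
  "PF \<equiv> polynomial_functions scale"

lemma linear_form_iff:
  "Vector_Spaces.linear scale (*) f \<longleftrightarrow>
    (\<forall>u v. f (u + v) = f u + f v) \<and> (\<forall>c v. f (scale c v) = c * f v)"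
proof -
  have "vector_space ((*) :: 'k \<Rightarrow> 'k \<Rightarrow> 'k)"
    by unfold_locales (auto simp: algebra_simps)
  then show ?thesis
    using vector_space_axioms by (auto simp: Vector_Spaces.linear_iff)
qed

lemma PF_induct [consumes 1, case_names const linear add mult]:
  assumes "f \<in> PF"
    and "\<And>c. P (\<lambda>_. c)"
    and "\<And>f. Vector_Spaces.linear scale (*) f \<Longrightarrow> P f"
    and "\<And>f g. f \<in> PF \<Longrightarrow> g \<in> PF \<Longrightarrow> P f \<Longrightarrow> P g \<Longrightarrow> P (f + g)"
    and "\<And>f g. f \<in> PF \<Longrightarrow> g \<in> PF \<Longrightarrow> P f \<Longrightarrow> P g \<Longrightarrow> P (f * g)"
  shows "P f"
  using assms(1) unfolding polynomial_functions_def
proof induction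
  case (add f g)
  then show ?case
    using assms(4)[of f g] by (simp add: plus_fun_def polynomial_functions_def)
next
  case (mult f g)
  then show ?case
    using assms(5)[of f g] by (simp add: times_fun_def polynomial_functions_def)
qed (use assms in auto)

lemma PF_const: "(\<lambda>_. c) \<in> PF"
  unfolding polynomial_functions_def by (rule generated_algebra.const)

lemma PF_linear: "Vector_Spaces.linear scale (*) f \<Longrightarrow> f \<in> PF"
  unfolding polynomial_functions_def by (rule generated_algebra.base) simp

lemma generated_algebra_PF: "B \<subseteq> PF \<Longrightarrow> generated_algebra B \<subseteq> PF"
  unfolding polynomial_functions_def by (rule generated_algebra_subset)

lemma PF_subspace: "fs.subspace PF"
  unfolding polynomial_functions_def by (rule generated_algebra_subspace)

lemma linear_form_coordinates:
  assumes "Vector_Spaces.linear scale (*) f"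
  shows "f v = (\<Sum>b\<in>Basis. representation Basis v b * f b)"
proof -
  interpret f: Vector_Spaces.linear scale "(*)" f by fact
  have "f v = f (\<Sum>b\<in>Basis. scale (representation Basis v b) b)"
    by (subst sum_representation_eq) (auto simp: independent_Basis span_Basis finite_Basis)
  also have "\<dots> = (\<Sum>b\<in>Basis. representation Basis v b * f b)"
    by (simp add: f.sum f.scale)
  finally show ?thesis .
qed

lemma linear_coordinate: "Vector_Spaces.linear scale (*) (\<lambda>v. representation Basis v b)"
  unfolding linear_form_iff
  by (auto simp: representation_add representation_scale independent_Basis span_Basis)

definition coordinates :: "('v \<Rightarrow> 'k) set" where
  "coordinates = (\<lambda>b v. representation Basis v b) ` Basis"

lemma PF_eq_coordinates: "PF = generated_algebra coordinates"
proof
  show "generated_algebra coordinates \<subseteq> PF"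
    by (rule generated_algebra_PF) (auto simp: coordinates_def intro: PF_linear linear_coordinate)
  have "f \<in> generated_algebra coordinates" if "Vector_Spaces.linear scale (*) f" for f
  proof -
    have "f = (\<Sum>b\<in>Basis. fscale (f b) (\<lambda>v. representation Basis v b))"
      by (rule ext, subst linear_form_coordinates[OF that]) (simp add: pointwise mult.commute)
    also have "\<dots> \<in> generated_algebra coordinates"
      by (intro generated_algebra_sum generated_algebra_fscale generated_algebra.base)
        (auto simp: coordinates_def)
    finally show ?thesis .
  qed
  then show "PF \<subseteq> generated_algebra coordinates"
    unfolding polynomial_functions_def by (intro generated_algebra_subset) auto
qed

lemma finite_coordinates: "finite coordinates"
  by (simp add: coordinates_def finite_Basis)

lemma exists_separating_form:
  assumes "u \<noteq> v"
  shows "\<exists>f. Vector_Spaces.linear scale (*) f \<and> f u \<noteq> f v"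
proof (rule ccontr)
  assume "\<not> ?thesis"
  then have "representation Basis u b = representation Basis v b" for b
    using linear_coordinate[of b] by blast
  then have "representation Basis u = representation Basis v" by blast
  then have "(\<Sum>b\<in>Basis. scale (representation Basis u b) b) =
      (\<Sum>b\<in>Basis. scale (representation Basis v b) b)" by simp
  moreover have "(\<Sum>b\<in>Basis. scale (representation Basis v b) b) = v" for v
    by (rule sum_representation_eq) (auto simp: independent_Basis span_Basis finite_Basis)
  ultimately show False using assms by metis
qed

lemma polynomial_on_line:
  assumes "f \<in> PF"
  shows "\<exists>q. \<forall>t. poly q t = f (u + scale t x)"
  using assms
proof (induction rule: PF_induct)
  case (const c)
  show ?case by (intro exI[of _ "[:c:]"]) simp
next
  case (linear f)
  then show ?case by (intro exI[of _ "[:f u, f x:]"]) (simp add: linear_form_iff)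
next
  case (add f g)
  then obtain p q where "\<forall>t. poly p t = f (u + scale t x)" "\<forall>t. poly q t = g (u + scale t x)"
    by blast
  then show ?case by (intro exI[of _ "p + q"]) (simp add: pointwise)
next
  case (mult f g)
  then obtain p q where "\<forall>t. poly p t = f (u + scale t x)" "\<forall>t. poly q t = g (u + scale t x)"
    by blast
  then show ?case by (intro exI[of _ "p * q"]) (simp add: pointwise)
qed

text \<open>
  The restriction of \<open>f\<close> to the line through \<open>x\<close>, as a polynomial in the line parameter. Its
  coefficient of degree \<open>d\<close>, as a function of \<open>x\<close>, is the homogeneous component of degree \<open>d\<close>;
  working with univariate polynomials gives multiplicativity and invariance of the grading at once.
\<close>
definition radial :: "('v \<Rightarrow> 'k) \<Rightarrow> 'v \<Rightarrow> 'k poly" where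
  "radial f x = (SOME q. \<forall>t. poly q t = f (scale t x))"

definition component :: "nat \<Rightarrow> ('v \<Rightarrow> 'k) \<Rightarrow> 'v \<Rightarrow> 'k" where
  "component d f = (\<lambda>x. coeff (radial f x) d)"

lemma radial_eqI:
  assumes "\<And>t. poly q t = f (scale t x)"
  shows "radial f x = q"
proof (rule poly_eqI_infinite[OF infinite_scalars])
  fix t
  have "\<forall>t. poly (radial f x) t = f (scale t x)"
    unfolding radial_def by (rule someI[of _ q]) (use assms in blast)
  then show "poly (radial f x) t = poly q t" using assms by simp
qed

lemma poly_radial:
  assumes "f \<in> PF"
  shows "poly (radial f x) t = f (scale t x)"
proof -
  obtain q where q: "\<And>t. poly q t = f (scale t x)"
    using polynomial_on_line[OF assms, of 0 x] by auto
  then show ?thesis using radial_eqI[of q f x] by simp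
qed

lemma radial_const: "radial (\<lambda>_. c) x = [:c:]"
  by (rule radial_eqI) simp

lemma radial_linear: "Vector_Spaces.linear scale (*) f \<Longrightarrow> radial f x = [:0, f x:]"
  by (rule radial_eqI) (simp add: linear_form_iff)

lemma radial_add: "f \<in> PF \<Longrightarrow> g \<in> PF \<Longrightarrow> radial (f + g) x = radial f x + radial g x"
  by (rule radial_eqI) (simp add: poly_radial pointwise)

lemma radial_times: "f \<in> PF \<Longrightarrow> g \<in> PF \<Longrightarrow> radial (f * g) x = radial f x * radial g x"
  by (rule radial_eqI) (simp add: poly_radial pointwise)

lemma radial_fscale: "f \<in> PF \<Longrightarrow> radial (fscale c f) x = smult c (radial f x)"
  by (rule radial_eqI) (simp add: poly_radial pointwise)

lemma component_const: "component d (\<lambda>_. c) = (if d = 0 then (\<lambda>_. c) else 0)"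
  by (auto simp: component_def radial_const fun_eq_iff pointwise coeff_pCons split: nat.splits)

lemma component_linear:
  "Vector_Spaces.linear scale (*) f \<Longrightarrow> component d f = (if d = 1 then f else 0)"
  by (auto simp: component_def radial_linear fun_eq_iff pointwise coeff_pCons split: nat.splits)

lemma component_add:
  "f \<in> PF \<Longrightarrow> g \<in> PF \<Longrightarrow> component d (f + g) = component d f + component d g"
  by (auto simp: component_def radial_add fun_eq_iff pointwise)

lemma component_fscale: "f \<in> PF \<Longrightarrow> component d (fscale c f) = fscale c (component d f)"
  by (auto simp: component_def radial_fscale fun_eq_iff pointwise)

lemma component_times:
  "f \<in> PF \<Longrightarrow> g \<in> PF \<Longrightarrow>
    component d (f * g) = (\<Sum>i\<le>d. component i f * component (d - i) g)"
  by (auto simp: component_def radial_times fun_eq_iff pointwise coeff_mult)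

lemma component_zero_fun: "component d 0 = 0"
  using component_const[of d 0] by (auto simp: zero_fun_def)

lemma component_0: "f \<in> PF \<Longrightarrow> component 0 f = (\<lambda>_. f 0)"
  using poly_radial[of f _ 0] by (auto simp: component_def poly_0_coeff_0 fun_eq_iff)

lemma component_at_0:
  assumes "f \<in> PF" "f 0 = 0"
  shows "component d f 0 = 0"
proof -
  have "radial f 0 = 0" by (rule radial_eqI) (simp add: assms)
  then show ?thesis by (simp add: component_def)
qed

lemma component_PF: "f \<in> PF \<Longrightarrow> component d f \<in> PF"
proof (induction arbitrary: d rule: PF_induct)
  case (const c)
  show ?case using PF_const PF_const[of 0] by (simp add: component_const zero_fun_def)
next
  case (linear f)
  then show ?case using PF_linear PF_const[of 0] by (simp add: component_linear zero_fun_def)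
next
  case (add f g)
  then show ?case using generated_algebra_add
    by (simp add: component_add) (simp add: polynomial_functions_def generated_algebra_add)
next
  case (mult f g)
  then show ?case
    by (simp add: component_times)
      (simp add: polynomial_functions_def generated_algebra_sum generated_algebra_times)
qed

lemma components_vanish_eventually: "f \<in> PF \<Longrightarrow> \<exists>N. \<forall>d\<ge>N. component d f = 0"
proof (induction rule: PF_induct)
  case (const c)
  show ?case by (intro exI[of _ 1]) (auto simp: component_const)
next
  case (linear f)
  then show ?case by (intro exI[of _ 2]) (auto simp: component_linear)
next
  case (add f g)
  then obtain N M where "\<forall>d\<ge>N. component d f = 0" "\<forall>d\<ge>M. component d g = 0" by blast
  with add show ?case by (intro exI[of _ "max N M"]) (simp add: component_add)
next
  case (mult f g)
  then obtain N M where NM: "\<forall>d\<ge>N. component d f = 0" "\<forall>d\<ge>M. component d g = 0" by blast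
  have "component d (f * g) = 0" if "d \<ge> N + M" for d
  proof -
    have "component i f * component (d - i) g = 0" for i
      using NM that by (cases "i \<ge> N") auto
    then show ?thesis using mult by (simp add: component_times)
  qed
  then show ?case by blast
qed

lemma sum_components:
  assumes "f \<in> PF" and N: "\<And>d. d \<ge> N \<Longrightarrow> component d f = 0"
  shows "(\<Sum>d<N. component d f) = f"
proof
  fix x
  have z: "coeff (radial f x) d = 0" if "d \<ge> N" for d
    using fun_cong[OF N[OF that], of x] by (simp add: component_def pointwise)
  have "f x = poly (radial f x) 1" using assms(1) by (simp add: poly_radial)
  also have "\<dots> = (\<Sum>i\<le>degree (radial f x). coeff (radial f x) i)" by (simp add: poly_altdef)
  also have "\<dots> = (\<Sum>d<N. coeff (radial f x) d)"
    by (rule sum.mono_neutral_cong) (auto simp: z not_le coeff_eq_0 not_less)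
  finally show "(\<Sum>d<N. component d f) x = f x" by (simp add: component_def pointwise)
qed

lemma component_component:
  assumes "f \<in> PF"
  shows "component e (component d f) = (if e = d then component d f else 0)"
proof -
  have "radial (component d f) x = monom (component d f x) d" for x
  proof (rule radial_eqI)
    fix t
    have "radial f (scale t x) = pcompose (radial f x) [:0, t:]"
      by (rule radial_eqI) (simp add: poly_pcompose poly_radial assms mult.commute)
    then show "poly (monom (component d f x) d) t = component d f (scale t x)"
      by (simp add: component_def poly_monom coeff_pcompose_linear mult.commute)
  qed
  then show ?thesis by (auto simp: component_def[of e] fun_eq_iff pointwise)
qed

lemma component_span:
  assumes "f \<in> fs.span A" "A \<subseteq> PF" "fs.subspace U" "\<And>a. a \<in> A \<Longrightarrow> component d a \<in> U"
  shows "component d f \<in> U"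
proof -
  let ?S = "{q \<in> PF. component d q \<in> U}"
  have "fs.subspace ?S"
    using assms(3) PF_subspace
    by (auto simp: fs.subspace_def component_add component_fscale component_zero_fun)
  then have "fs.span A \<subseteq> ?S" using assms(2,4) by (intro fs.span_minimal) auto
  then show ?thesis using assms(1) by blast
qed

section \<open>Generators of a graded algebra\<close>

text \<open>
  Let \<open>M\<close> be the ideal of elements of \<open>R\<close> vanishing at the origin and \<open>Q\<close> the span of the products
  of two of them. An element of \<open>M\<close> agrees in low degrees with a polynomial in \<open>B\<close>, and modulo \<open>Q\<close>
  only the linear part of that polynomial survives; so \<open>M / Q\<close> has dimension at most \<open>card B\<close>. A
  set \<open>T\<close> of homogeneous elements of \<open>M\<close> representing a basis of \<open>M / Q\<close> generates \<open>R\<close>, by induction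
  on the degree: the degree \<open>d\<close> component of a product of two elements of \<open>M\<close> only involves
  components of degree below \<open>d\<close>.
  The set \<open>B\<close> is compared with \<open>R\<close> only degree by degree because the translated generators to
  which this will be applied are inhomogeneous.
\<close>
lemma graded_algebra_generators:
  assumes R: "R \<subseteq> PF" "generated_algebra R \<subseteq> R"
    and graded: "\<And>f d. f \<in> R \<Longrightarrow> component d f \<in> R"
    and B: "finite B" "B \<subseteq> R"
    and approx: "\<And>h N. h \<in> R \<Longrightarrow> \<exists>P\<in>generated_algebra B. \<forall>d<N. component d P = component d h"
  shows "\<exists>T\<subseteq>R. finite T \<and> card T \<le> card B \<and> generated_algebra T = R"
proof -
  have gR: "generated_algebra R = R" using R(2) generated_algebra.base by blast
  have R_sub: "fs.subspace R" using generated_algebra_subspace[of R] gR by simp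
  have R_times: "f * g \<in> R" if "f \<in> R" "g \<in> R" for f g
    using generated_algebra_times[of f R g] that gR by simp
  have R_const: "(\<lambda>_. c) \<in> R" for c using generated_algebra.const[of c R] gR by simp
  define M where "M = {f \<in> R. f 0 = 0}"
  have M_sub: "fs.subspace M"
    using R_sub by (auto simp: fs.subspace_def M_def pointwise)
  define Q where "Q = fs.span {f * g |f g. f \<in> M \<and> g \<in> M}"
  have Q_sub: "fs.subspace Q" by (simp add: Q_def)
  have Q_prod: "f * g \<in> Q" if "f \<in> M" "g \<in> M" for f g
    unfolding Q_def using that by (intro fs.span_base) blast
  have QM: "Q \<subseteq> M"
    unfolding Q_def by (rule fs.span_minimal[OF _ M_sub]) (auto simp: M_def R_times pointwise)
  have MP: "M \<subseteq> PF" using R by (auto simp: M_def)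
  have M_comp: "component d f \<in> M" if "f \<in> M" for d f
    using that R component_at_0[of f d] by (auto simp: M_def graded)
  have Q_comp: "component d q \<in> Q" if "q \<in> Q" for d q
  proof (rule component_span[OF that[unfolded Q_def] _ Q_sub])
    show "{f * g |f g. f \<in> M \<and> g \<in> M} \<subseteq> PF" using R R_times by (auto simp: M_def)
    fix a assume "a \<in> {f * g |f g. f \<in> M \<and> g \<in> M}"
    then obtain f g where fg: "a = f * g" "f \<in> M" "g \<in> M" by blast
    then have "component d a = (\<Sum>i\<le>d. component i f * component (d - i) g)"
      using MP component_times[of f g d] by auto
    also have "\<dots> \<in> Q" using fg M_comp Q_prod Q_sub by (intro fs.subspace_sum) auto
    finally show "component d a \<in> Q" .
  qed
  \<comment> \<open>Polynomials in \<open>B\<close> need not lie in \<open>M\<close>. Removing the constant terms leaves \<open>gen\<close> below: a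
    polynomial in \<open>B\<close> is its constant term plus a linear combination of shifted generators plus
    decomposable elements.\<close>
  define shift where "shift f = f - (\<lambda>_. f 0)" for f :: "'v \<Rightarrow> 'k"
  have shift_M: "shift f \<in> M" if "f \<in> R" for f
    using that R_const R_sub by (auto simp: M_def shift_def pointwise intro: fs.subspace_diff)
  have gBR: "generated_algebra B \<subseteq> R" using generated_algebra_subset[of B R] B gR by simp
  have gen: "shift P \<in> fs.span (shift ` B \<union> Q)" if "P \<in> generated_algebra B" for P
    using that
  proof induction
    case (const c)
    have "shift (\<lambda>_. c) = 0" by (auto simp: shift_def fun_eq_iff pointwise)
    then show ?case using fs.span_zero by metis
  next
    case (base f)
    then show ?case by (intro fs.span_base) auto
  next
    case (add f g)
    have "shift (\<lambda>v. f v + g v) = shift f + shift g"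
      by (auto simp: shift_def fun_eq_iff pointwise)
    with add.IH show ?case by (simp only: fs.span_add)
  next
    case (mult f g)
    have "shift (\<lambda>v. f v * g v) = shift f * shift g + fscale (f 0) (shift g) + fscale (g 0) (shift f)"
      by (auto simp: shift_def fun_eq_iff pointwise algebra_simps)
    moreover have "shift f * shift g \<in> fs.span (shift ` B \<union> Q)"
      using mult.hyps gBR by (intro fs.span_base UnI2 Q_prod shift_M) auto
    ultimately show ?case using mult.IH by (simp only: fs.span_add fs.span_scale)
  qed
  define trunc where "trunc N f = (\<Sum>d<N. component d f)" for N f
  define indmod where
    "indmod T \<longleftrightarrow> (\<forall>c. (\<Sum>t\<in>T. fscale (c t) t) \<in> Q \<longrightarrow> (\<forall>t\<in>T. c t = 0))" for T
  have bound: "card T \<le> card B" if T: "finite T" "T \<subseteq> M" "indmod T" for T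
  proof -
    have "\<forall>t\<in>T. \<exists>N. \<forall>d\<ge>N. component d t = 0"
      using components_vanish_eventually T(2) MP by blast
    then obtain N' where N': "\<And>t d. t \<in> T \<Longrightarrow> d \<ge> N' t \<Longrightarrow> component d t = 0" by metis
    define N where "N = Suc (\<Sum>t\<in>T. N' t)"
    have N: "component d t = 0" if "t \<in> T" "d \<ge> N" for t d
    proof -
      have "N' t \<le> (\<Sum>t\<in>T. N' t)" using T(1) that by (intro member_le_sum) auto
      then show ?thesis using that by (intro N') (auto simp: N_def)
    qed
    define D where "D = trunc N ` shift ` B"
    have in_span: "t \<in> fs.span (D \<union> Q)" if "t \<in> T" for t
    proof -
      have t: "t \<in> M" "t \<in> R" "t \<in> PF" using that T(2) MP by (auto simp: M_def)
      obtain P where P: "P \<in> generated_algebra B" "\<And>d. d < N \<Longrightarrow> component d P = component d t"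
        using approx[OF t(2)] by blast
      have PPF: "P \<in> PF" "shift P \<in> PF" using P(1) gBR R shift_M MP by blast+
      have "(\<lambda>_ :: 'v. P 0) = (\<lambda>_. t 0)"
        using P(2)[of 0] component_0[OF PPF(1)] component_0[OF t(3)] by (simp add: N_def)
      then have "P 0 = 0" using t(1) by (auto simp: M_def dest: fun_cong)
      then have "shift P = P" by (auto simp: shift_def fun_eq_iff pointwise)
      have "trunc N P \<in> fs.span (D \<union> Q)"
      proof -
        let ?S = "{f \<in> PF. trunc N f \<in> fs.span (D \<union> Q)}"
        have "fs.subspace ?S"
          unfolding fs.subspace_def
        proof (intro conjI ballI allI)
          show "0 \<in> ?S" using PF_subspace
            by (auto simp: trunc_def component_zero_fun fs.span_zero fs.subspace_0)
          fix f assume f: "f \<in> ?S"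
          show "fscale c f \<in> ?S" for c
          proof -
            have "trunc N (fscale c f) = fscale c (trunc N f)"
              using f by (simp add: trunc_def component_fscale fs.scale_sum_right)
            then show ?thesis using f PF_subspace fs.span_scale
              by (auto simp: fs.subspace_scale)
          qed
          fix g assume g: "g \<in> ?S"
          have "trunc N (f + g) = trunc N f + trunc N g"
            using f g by (simp add: trunc_def component_add sum.distrib)
          then show "f + g \<in> ?S" using f g PF_subspace fs.span_add
            by (auto simp: fs.subspace_add)
        qed
        moreover have "shift ` B \<union> Q \<subseteq> ?S"
        proof -
          have "trunc N q \<in> fs.span (D \<union> Q)" if "q \<in> Q" for q
            unfolding trunc_def using that Q_comp by (intro fs.span_sum fs.span_base) auto
          moreover have "shift b \<in> PF" "trunc N (shift b) \<in> fs.span (D \<union> Q)" if "b \<in> B" for b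
            using that B shift_M MP by (auto simp: D_def intro!: fs.span_base)
          ultimately show ?thesis using QM MP by blast
        qed
        ultimately have "fs.span (shift ` B \<union> Q) \<subseteq> ?S" by (intro fs.span_minimal)
        then show ?thesis using gen[OF P(1)] \<open>shift P = P\<close> by auto
      qed
      moreover have "trunc N P = t"
        using sum_components[OF t(3) N[OF that]] P(2) by (simp add: trunc_def)
      ultimately show ?thesis by simp
    qed
    \<comment> \<open>Correcting each \<open>t\<close> by an element of \<open>Q\<close> turns independence modulo \<open>Q\<close> into ordinary
      independence inside the span of the at most \<open>card B\<close> elements of \<open>D\<close>.\<close>
    have "\<exists>q\<in>Q. t - q \<in> fs.span D" if "t \<in> T" for t
    proof -
      have "t \<in> {x + y |x y. x \<in> fs.span D \<and> y \<in> fs.span Q}"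
        using in_span[OF that] by (simp add: fs.span_Un)
      then obtain x y where "t = x + y" "x \<in> fs.span D" "y \<in> fs.span Q" by blast
      moreover have "fs.span Q = Q" using Q_sub by (simp add: fs.span_eq_iff)
      ultimately show ?thesis by (intro bexI[of _ y]) auto
    qed
    then obtain q where q: "\<And>t. t \<in> T \<Longrightarrow> q t \<in> Q" "\<And>t. t \<in> T \<Longrightarrow> t - q t \<in> fs.span D" by metis
    define s where "s t = t - q t" for t
    have lin: "c t = 0" if c: "(\<Sum>t\<in>T. fscale (c t) (s t)) = 0" and t: "t \<in> T" for c t
    proof -
      have "(\<Sum>t\<in>T. fscale (c t) t) = (\<Sum>t\<in>T. fscale (c t) (q t))"
        using c by (simp add: s_def fs.scale_right_diff_distrib sum_subtractf)
      also have "\<dots> \<in> Q" using q(1) Q_sub by (intro fs.subspace_sum fs.subspace_scale) auto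
      finally show ?thesis using T(3) t by (auto simp: indmod_def)
    qed
    have inj: "inj_on s T"
    proof (rule inj_onI, rule ccontr)
      fix a b assume ab: "a \<in> T" "b \<in> T" "s a = s b" "a \<noteq> b"
      let ?c = "\<lambda>t. if t = a then 1 else if t = b then - 1 else 0 :: 'k"
      have "(\<Sum>t\<in>T. fscale (?c t) (s t)) = (\<Sum>t\<in>{a,b}. fscale (?c t) (s t))"
        using T(1) ab by (intro sum.mono_neutral_right) (auto simp: fun_eq_iff pointwise)
      also have "\<dots> = 0" using ab by (auto simp: fun_eq_iff pointwise)
      finally show False using lin[of ?c a] ab by auto
    qed
    have "fs.independent (s ` T)"
    proof (rule fs.independent_if_scalars_zero)
      fix c x assume "(\<Sum>x\<in>s ` T. fscale (c x) x) = 0" "x \<in> s ` T"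
      then show "c x = 0" using lin[of "\<lambda>t. c (s t)"] by (auto simp: sum.reindex[OF inj])
    qed (use T in simp)
    moreover have "s ` T \<subseteq> fs.span D" using q(2) by (auto simp: s_def)
    moreover have "finite D" using B by (simp add: D_def)
    ultimately have "card (s ` T) \<le> card D" using fs.independent_span_bound by blast
    also have "card D \<le> card B"
      unfolding D_def by (metis B(1) card_image_le finite_imageI le_trans)
    finally show ?thesis using inj by (simp add: card_image)
  qed
  \<comment> \<open>The bound on the size of sets independent modulo \<open>Q\<close> provides a maximal one among the sets of
    homogeneous elements; by maximality it spans all homogeneous elements modulo \<open>Q\<close>.\<close>
  define Hom where "Hom = {h \<in> M. \<exists>d. component d h = h}"
  have "\<exists>T. (T \<subseteq> Hom \<and> finite T \<and> indmod T) \<and>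
    (\<forall>T'. T' \<subseteq> Hom \<and> finite T' \<and> indmod T' \<longrightarrow> card T' \<le> card T)"
  proof (rule ex_has_greatest_nat[of _ "{}" card "Suc (card B)"])
    show "{} \<subseteq> Hom \<and> finite {} \<and> indmod {}" by (simp add: indmod_def)
    show "\<forall>T. T \<subseteq> Hom \<and> finite T \<and> indmod T \<longrightarrow> card T < Suc (card B)"
      using bound by (force simp: Hom_def less_Suc_eq_le)
  qed
  then obtain T where T: "T \<subseteq> Hom" "finite T" "indmod T"
    and max: "\<And>T'. T' \<subseteq> Hom \<Longrightarrow> finite T' \<Longrightarrow> indmod T' \<Longrightarrow> card T' \<le> card T" by blast
  have TR: "T \<subseteq> R" using T(1) by (auto simp: Hom_def M_def)
  have Hom_span: "h \<in> fs.span (T \<union> Q)" if h: "h \<in> Hom" for h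
  proof (rule ccontr)
    assume nh: "h \<notin> fs.span (T \<union> Q)"
    then have hT: "h \<notin> T" using fs.span_base[of h "T \<union> Q"] by blast
    have "indmod (insert h T)"
      unfolding indmod_def
    proof (intro allI impI)
      fix c assume c: "(\<Sum>t\<in>insert h T. fscale (c t) t) \<in> Q"
      define S where "S = (\<Sum>t\<in>T. fscale (c t) t)"
      have eq: "(\<Sum>t\<in>insert h T. fscale (c t) t) = fscale (c h) h + S"
        using hT T(2) by (simp add: S_def)
      have "c h = 0"
      proof (rule ccontr)
        assume nz: "c h \<noteq> 0"
        have "S \<in> fs.span (T \<union> Q)"
          unfolding S_def by (intro fs.span_sum fs.span_scale fs.span_base) auto
        moreover have "fscale (c h) h + S \<in> fs.span (T \<union> Q)"
          using c eq by (intro fs.span_base) auto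
        ultimately have "fscale (c h) h + S - S \<in> fs.span (T \<union> Q)" by (intro fs.span_diff)
        then have "fscale (inverse (c h)) (fscale (c h) h) \<in> fs.span (T \<union> Q)"
          by (simp only: add_diff_cancel_right' fs.span_scale)
        moreover have "fscale (inverse (c h)) (fscale (c h) h) = h"
          using nz by (simp add: fun_eq_iff pointwise)
        ultimately show False using nh by simp
      qed
      then have "S \<in> Q" using c eq by simp
      then show "\<forall>t\<in>insert h T. c t = 0" using T(3) \<open>c h = 0\<close> by (auto simp: indmod_def S_def)
    qed
    then have "card (insert h T) \<le> card T" using T h by (intro max) auto
    then show False using hT T(2) by simp
  qed
  have comp_gen: "component d r \<in> generated_algebra T" if "r \<in> R" for r d
    using that
  proof (induction d arbitrary: r rule: less_induct)
    case (less d)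
    show ?case
    proof (cases "d = 0")
      case True
      have "r \<in> PF" using less.prems R(1) by blast
      then show ?thesis using True by (simp add: component_0 generated_algebra.const)
    next
      case False
      define h where "h = component d r"
      have rP: "r \<in> PF" using less.prems R by blast
      have "h 0 = 0"
        using component_0[of h] component_PF[OF rP, of d] component_component[OF rP, of 0 d] False
        by (simp add: h_def zero_fun_def) (metis)
      then have "h \<in> Hom"
        using graded[OF less.prems] component_component[OF rP, of d d]
        by (auto simp: Hom_def M_def h_def)
      then have "h \<in> fs.span (T \<union> Q)" by (rule Hom_span)
      then have "h \<in> fs.span (T \<union> {f * g |f g. f \<in> M \<and> g \<in> M})"
        unfolding Q_def by (simp only: fs.span_Un fs.span_span)
      then have "component d h \<in> generated_algebra T"
      proof (rule component_span)
        show "T \<union> {f * g |f g. f \<in> M \<and> g \<in> M} \<subseteq> PF" using TR R R_times by (auto simp: M_def)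
        show "fs.subspace (generated_algebra T)" by (rule generated_algebra_subspace)
        fix a assume "a \<in> T \<union> {f * g |f g. f \<in> M \<and> g \<in> M}"
        then show "component d a \<in> generated_algebra T"
        proof
          assume a: "a \<in> T"
          then obtain e where "component e a = a" using T(1) by (auto simp: Hom_def)
          then have "component d a = (if d = e then a else 0)"
            using component_component[of a d e] a TR R by auto
          then show ?thesis using a generated_algebra.base generated_algebra_zero by metis
        next
          assume "a \<in> {f * g |f g. f \<in> M \<and> g \<in> M}"
          then obtain f g where fg: "a = f * g" "f \<in> M" "g \<in> M" by blast
          then have fgP: "f \<in> PF" "g \<in> PF" "f \<in> R" "g \<in> R" "f 0 = 0" "g 0 = 0"
            using MP by (auto simp: M_def)
          have "component i f * component (d - i) g \<in> generated_algebra T" if "i \<le> d" for i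
          proof (cases "i = 0 \<or> i = d")
            case True
            then have "component i f * component (d - i) g = 0"
              using component_0 fgP by (auto simp: fun_eq_iff pointwise)
            then show ?thesis using generated_algebra_zero by metis
          next
            case False
            then show ?thesis using that less.IH fgP by (intro generated_algebra_times) auto
          qed
          then show ?thesis
            unfolding fg(1) component_times[OF fgP(1,2)] by (intro generated_algebra_sum) simp
        qed
      qed
      then show ?thesis using component_component[OF rP, of d d] by (simp add: h_def)
    qed
  qed
  have "R \<subseteq> generated_algebra T"
  proof
    fix r assume r: "r \<in> R"
    then obtain N where "\<forall>d\<ge>N. component d r = 0" using components_vanish_eventually R by blast
    then have "r = (\<Sum>d<N. component d r)" using sum_components[of r N] r R by auto
    also have "\<dots> \<in> generated_algebra T" using comp_gen[OF r] by (intro generated_algebra_sum)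
    finally show "r \<in> generated_algebra T" .
  qed
  moreover have "generated_algebra T \<subseteq> R" using generated_algebra_subset[of T R] TR gR by simp
  moreover have "card T \<le> card B" using T by (intro bound) (auto simp: Hom_def)
  ultimately show ?thesis using TR T(2) by blast
qed

section \<open>Invariants near a vector\<close>

lemma PF_add: "f \<in> PF \<Longrightarrow> g \<in> PF \<Longrightarrow> f + g \<in> PF"
  unfolding polynomial_functions_def by (rule generated_algebra_add)

lemma PF_diff: "f \<in> PF \<Longrightarrow> g \<in> PF \<Longrightarrow> f - g \<in> PF"
  unfolding polynomial_functions_def by (rule generated_algebra_diff)

lemma PF_times: "f \<in> PF \<Longrightarrow> g \<in> PF \<Longrightarrow> f * g \<in> PF"
  unfolding polynomial_functions_def by (rule generated_algebra_times)

lemma PF_one: "1 \<in> PF"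
  unfolding polynomial_functions_def by (rule generated_algebra_one)

lemma PF_sum: "(\<And>i. i \<in> I \<Longrightarrow> f i \<in> PF) \<Longrightarrow> (\<Sum>i\<in>I. f i) \<in> PF"
  unfolding polynomial_functions_def by (rule generated_algebra_sum)

lemma PF_prod: "(\<And>i. i \<in> I \<Longrightarrow> f i \<in> PF) \<Longrightarrow> (\<Prod>i\<in>I. f i) \<in> PF"
  unfolding polynomial_functions_def by (rule generated_algebra_prod)

lemma PF_power: "f \<in> PF \<Longrightarrow> f ^ n \<in> PF"
  unfolding polynomial_functions_def by (rule generated_algebra_power)

lemma linear_map_iff:
  "Vector_Spaces.linear scale scale g \<longleftrightarrow>
    (\<forall>u v. g (u + v) = g u + g v) \<and> (\<forall>c v. g (scale c v) = scale c (g v))"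
  using vector_space_axioms by (auto simp: Vector_Spaces.linear_iff)

lemma PF_affine:
  assumes "f \<in> PF" and g: "Vector_Spaces.linear scale scale g"
  shows "(\<lambda>x. f (u + g x)) \<in> PF"
  using assms(1)
proof (induction rule: PF_induct)
  case (const c)
  show ?case by (rule PF_const)
next
  case (linear f)
  then have "(\<lambda>x. f (u + g x)) = (\<lambda>_. f u) + (\<lambda>x. f (g x))"
    by (simp add: linear_form_iff fun_eq_iff pointwise)
  moreover have "Vector_Spaces.linear scale (*) (\<lambda>x. f (g x))"
    using linear g by (simp add: linear_form_iff linear_map_iff)
  ultimately show ?case using PF_add[OF PF_const PF_linear] by metis
next
  case (add f h)
  have "(\<lambda>x. (f + h) (u + g x)) = (\<lambda>x. f (u + g x)) + (\<lambda>x. h (u + g x))"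
    by (simp add: fun_eq_iff pointwise)
  with add.IH show ?case by (simp only: PF_add)
next
  case (mult f h)
  have "(\<lambda>x. (f * h) (u + g x)) = (\<lambda>x. f (u + g x)) * (\<lambda>x. h (u + g x))"
    by (simp add: fun_eq_iff pointwise)
  with mult.IH show ?case by (simp only: PF_times)
qed

lemma PF_translate: "f \<in> PF \<Longrightarrow> (\<lambda>x. f (u + x)) \<in> PF"
  using PF_affine[of f id u] by (simp add: linear_map_iff)

lemma PF_compose: "f \<in> PF \<Longrightarrow> Vector_Spaces.linear scale scale g \<Longrightarrow> f \<circ> g \<in> PF"
  using PF_affine[of f g 0] by (simp add: comp_def)

text \<open>
  Vanishing of order \<open>N\<close> at \<open>u\<close>, tested on all lines through \<open>u\<close>. This form is visibly stable
  under sums, multiples and linear substitutions, and it translates directly into vanishing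
  components.
\<close>
definition vanishes :: "nat \<Rightarrow> ('v \<Rightarrow> 'k) \<Rightarrow> 'v \<Rightarrow> bool" where
  "vanishes N f u \<longleftrightarrow> (\<forall>x. \<exists>q. \<forall>t. f (u + scale t x) = t ^ N * poly q t)"

lemma vanishes_add:
  assumes "vanishes N f u" "vanishes N g u"
  shows "vanishes N (f + g) u"
  unfolding vanishes_def
proof
  fix x
  obtain p q where "\<forall>t. f (u + scale t x) = t ^ N * poly p t"
    "\<forall>t. g (u + scale t x) = t ^ N * poly q t"
    using assms unfolding vanishes_def by blast
  then show "\<exists>q. \<forall>t. (f + g) (u + scale t x) = t ^ N * poly q t"
    by (intro exI[of _ "p + q"]) (simp add: pointwise algebra_simps)
qed

lemma vanishes_times:
  assumes "vanishes N f u" "g \<in> PF"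
  shows "vanishes N (f * g) u"
  unfolding vanishes_def
proof
  fix x
  obtain p where "\<forall>t. f (u + scale t x) = t ^ N * poly p t"
    using assms(1) unfolding vanishes_def by blast
  moreover obtain q where "\<forall>t. poly q t = g (u + scale t x)"
    using polynomial_on_line[OF assms(2)] by blast
  ultimately show "\<exists>q. \<forall>t. (f * g) (u + scale t x) = t ^ N * poly q t"
    by (intro exI[of _ "p * q"]) (simp add: pointwise algebra_simps)
qed

lemma vanishes_zero: "vanishes N 0 u"
  unfolding vanishes_def by (auto intro!: exI[of _ 0] simp: pointwise)

lemma vanishes_sum: "(\<And>i. i \<in> I \<Longrightarrow> vanishes N (f i) u) \<Longrightarrow> vanishes N (\<Sum>i\<in>I. f i) u"
  by (induction I rule: infinite_finite_induct) (auto intro: vanishes_zero vanishes_add)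

lemma vanishes_power:
  assumes "f \<in> PF" "f u = 0"
  shows "vanishes N (f ^ N) u"
  unfolding vanishes_def
proof
  fix x
  obtain q where q: "\<forall>t. poly q t = f (u + scale t x)"
    using polynomial_on_line[OF assms(1)] by blast
  then have "poly q 0 = 0" using assms(2) by simp
  then obtain r where "q = [:0, 1:] * r" by (auto simp: poly_eq_0_iff_dvd elim: dvdE)
  then have "\<forall>t. f (u + scale t x) = t * poly r t" by (simp flip: q[rule_format])
  then show "\<exists>q. \<forall>t. (f ^ N) (u + scale t x) = t ^ N * poly q t"
    by (intro exI[of _ "r ^ N"]) (simp add: pointwise power_mult_distrib)
qed

lemma vanishes_compose:
  assumes "vanishes N f (g u)" "Vector_Spaces.linear scale scale g"
  shows "vanishes N (f \<circ> g) u"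
  using assms unfolding vanishes_def linear_map_iff by simp

lemma vanishes_component:
  assumes "vanishes N f u" "d < N"
  shows "component d (\<lambda>x. f (u + x)) = 0"
proof
  fix x
  obtain q where "\<And>t. f (u + scale t x) = t ^ N * poly q t"
    using assms(1) unfolding vanishes_def by blast
  then have "radial (\<lambda>x. f (u + x)) x = monom 1 N * q"
    by (intro radial_eqI) (simp add: poly_monom)
  then show "component d (\<lambda>x. f (u + x)) x = 0 x"
    using assms(2) by (simp add: component_def coeff_monom_mult pointwise)
qed

text \<open>
  A product \<open>p\<close> of affine functions is \<open>1\<close> at \<open>v\<close> and \<open>0\<close> on \<open>S\<close>. With \<open>y = p\<^sup>N\<close>, the function
  \<open>1 - (1 - y)\<^sup>N\<close> is a multiple of \<open>y\<close>, hence vanishes to order \<open>N\<close> on \<open>S\<close>, and differs from \<open>1\<close> by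
  the \<open>N\<close>-th power of a function vanishing at \<open>v\<close>.
\<close>
lemma exists_bump:
  assumes "finite S" "v \<notin> S"
  shows "\<exists>e\<in>PF. vanishes N (e - 1) v \<and> (\<forall>u\<in>S. vanishes N e u)"
proof -
  have "\<exists>f. f \<in> PF \<and> f u = 0 \<and> f v = 1" if u: "u \<in> S" for u
  proof -
    obtain l where l: "Vector_Spaces.linear scale (*) l" "l u \<noteq> l v"
      using exists_separating_form[of u v] u assms(2) by blast
    have "(\<lambda>_. 1 / (l v - l u)) * (l - (\<lambda>_. l u)) \<in> PF"
      by (intro PF_times PF_diff PF_const PF_linear l)
    then show ?thesis using l(2)
      by (intro exI[of _ "(\<lambda>_. 1 / (l v - l u)) * (l - (\<lambda>_. l u))"]) (simp add: pointwise)
  qed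
  then obtain a where a: "\<And>u. u \<in> S \<Longrightarrow> a u \<in> PF \<and> a u u = 0 \<and> a u v = 1" by metis
  define p where "p = (\<Prod>u\<in>S. a u)"
  have p: "p \<in> PF" "p v = 1" "\<And>u. u \<in> S \<Longrightarrow> p u = 0"
    using a assms(1) by (auto simp: p_def pointwise intro!: PF_prod)
  define e where "e = 1 - (1 - p ^ N) ^ N"
  have e: "e \<in> PF" unfolding e_def by (intro PF_diff PF_one PF_power p)
  have "vanishes N ((1 - p ^ N) ^ N) v"
    using p by (intro vanishes_power PF_diff PF_one PF_power) (auto simp: pointwise)
  moreover have "e - 1 = (1 - p ^ N) ^ N * (\<lambda>_. - 1)"
    by (simp add: e_def fun_eq_iff pointwise)
  ultimately have "vanishes N (e - 1) v" by (simp only: vanishes_times PF_const)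
  moreover have "vanishes N e u" if "u \<in> S" for u
  proof -
    have "e = p ^ N * (\<Sum>i<N. (1 - p ^ N) ^ i)"
      using one_diff_power_eq[of "1 - p ^ N" N] by (simp add: e_def)
    moreover have "vanishes N (p ^ N) u" using p that by (intro vanishes_power)
    moreover have "(\<Sum>i<N. (1 - p ^ N) ^ i) \<in> PF"
      by (intro PF_sum PF_power PF_diff PF_one p)
    ultimately show ?thesis by (simp only: vanishes_times)
  qed
  ultimately show ?thesis using e by blast
qed

definition linear_group :: "('v \<Rightarrow> 'v) set \<Rightarrow> bool" where
  "linear_group G \<longleftrightarrow> id \<in> G \<and> (\<forall>g\<in>G. \<forall>h\<in>G. g \<circ> h \<in> G) \<and>
    (\<forall>g\<in>G. Vector_Spaces.linear scale scale g \<and> bij g \<and> inv_into UNIV g \<in> G)"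

lemma linear_groupD:
  assumes "linear_group G"
  shows "id \<in> G" "\<And>g h. g \<in> G \<Longrightarrow> h \<in> G \<Longrightarrow> g \<circ> h \<in> G"
    "\<And>g. g \<in> G \<Longrightarrow> Vector_Spaces.linear scale scale g" "\<And>g. g \<in> G \<Longrightarrow> bij g"
    "\<And>g. g \<in> G \<Longrightarrow> inv_into UNIV g \<in> G"
  using assms by (auto simp: linear_group_def)

lemma linear_group_stabilizer:
  assumes "linear_group G"
  shows "linear_group (pointwise_stabilizer G W)"
proof -
  have "inv_into UNIV g w = w" if "g \<in> G" "g w = w" for g w
    using bij_inv_eq_iff[OF linear_groupD(4)[OF assms that(1)], of w w] that(2) by simp
  then show ?thesis
    using assms by (auto simp: linear_group_def pointwise_stabilizer_def)
qed

lemma invariant_ring_PF: "invariant_ring scale G \<subseteq> PF"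
  by (auto simp: invariant_ring_def)

lemma generated_algebra_invariant_ring:
  "generated_algebra (invariant_ring scale G) = invariant_ring scale G"
proof
  show "generated_algebra (invariant_ring scale G) \<subseteq> invariant_ring scale G"
  proof
    fix f assume f: "f \<in> generated_algebra (invariant_ring scale G)"
    then have "f \<in> PF" using generated_algebra_PF[OF invariant_ring_PF] by blast
    moreover have "\<forall>g\<in>G. \<forall>v. f (g v) = f v"
      using f by induction (auto simp: invariant_ring_def)
    ultimately show "f \<in> invariant_ring scale G" by (simp add: invariant_ring_def)
  qed
qed (auto intro: generated_algebra.base)

lemma component_invariant:
  assumes G: "\<And>g. g \<in> G \<Longrightarrow> Vector_Spaces.linear scale scale g"
    and f: "f \<in> invariant_ring scale G"
  shows "component d f \<in> invariant_ring scale G"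
proof -
  have fP: "f \<in> PF" "\<And>g x. g \<in> G \<Longrightarrow> f (g x) = f x" using f by (auto simp: invariant_ring_def)
  have "radial f (g x) = radial f x" if "g \<in> G" for g x
  proof (rule radial_eqI)
    fix t
    have "scale t (g x) = g (scale t x)" using G[OF that] by (simp add: linear_map_iff)
    then show "poly (radial f x) t = f (scale t (g x))" using fP that by (simp add: poly_radial)
  qed
  then show ?thesis using component_PF[OF fP(1)] by (simp add: invariant_ring_def component_def)
qed

text \<open>
  Every invariant of the stabilizer of \<open>v\<close>, moved to \<open>v\<close>, agrees there to order \<open>N\<close> with an
  invariant of the whole group. The invariant is cut off near the other points of the orbit of \<open>v\<close>
  by the function \<open>E\<close> below, and then its distinct translates are added up; dividing by the order
  of the group would fail when the characteristic divides that order.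
\<close>
lemma lift_local_invariant:
  assumes G: "linear_group G" "finite G"
    and h: "h \<in> invariant_ring scale (pointwise_stabilizer G {v})"
  shows "\<exists>P\<in>invariant_ring scale G. \<forall>d<N. component d (\<lambda>x. P (v + x)) = component d h"
proof -
  define H where "H = pointwise_stabilizer G {v}"
  have H: "linear_group H" "finite H" "\<And>g. g \<in> H \<longleftrightarrow> g \<in> G \<and> g v = v"
    using linear_group_stabilizer[OF G(1), of "{v}"] G(2)
    by (auto simp: H_def pointwise_stabilizer_def)
  define S where "S = (\<lambda>g. g v) ` G - {v}"
  obtain e where e: "e \<in> PF" "vanishes N (e - 1) v" "\<And>u. u \<in> S \<Longrightarrow> vanishes N e u"
    using exists_bump[of S v N] G(2) by (auto simp: S_def)
  define E where "E = (\<Prod>g\<in>H. e \<circ> g)"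
  have eg: "e \<circ> g \<in> PF" if "g \<in> H" for g
    using PF_compose[OF e(1)] linear_groupD(3)[OF H(1) that] by blast
  have E: "E \<in> PF" unfolding E_def using eg by (intro PF_prod)
  have E_inv: "E (k x) = E x" if k: "k \<in> H" for k x
  proof -
    have "(\<Prod>g\<in>H. e (g (k x))) = (\<Prod>g\<in>H. e (g x))"
    proof (rule prod.reindex_bij_witness[of _ "\<lambda>g. g \<circ> inv_into UNIV k" "\<lambda>g. g \<circ> k"])
      fix g assume g: "g \<in> H"
      have bij: "bij k" using linear_groupD(4)[OF H(1) k] .
      show "g \<circ> k \<circ> inv_into UNIV k = g" "g \<circ> inv_into UNIV k \<circ> k = g"
        using bij by (auto simp: fun_eq_iff bij_is_surj bij_is_inj surj_f_inv_f)
      show "g \<circ> k \<in> H" "g \<circ> inv_into UNIV k \<in> H"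
        using linear_groupD(2)[OF H(1) g] linear_groupD(5)[OF H(1) k] k by auto
      show "e ((g \<circ> k) x) = e (g (k x))" by simp
    qed
    then show ?thesis by (simp add: E_def pointwise)
  qed
  have E_S: "vanishes N E u" if "u \<in> S" for u
  proof -
    have "E = (e \<circ> id) * (\<Prod>g\<in>H-{id}. e \<circ> g)"
      unfolding E_def using H(2) linear_groupD(1)[OF H(1)] by (rule prod.remove)
    moreover have "vanishes N (e \<circ> id) u" using e(3)[OF that] by simp
    moreover have "(\<Prod>g\<in>H-{id}. e \<circ> g) \<in> PF" using eg by (intro PF_prod) auto
    ultimately show ?thesis by (simp only: vanishes_times)
  qed
  have "vanishes N ((\<Prod>g\<in>K. e \<circ> g) - 1) v" if "K \<subseteq> H" for K
    using finite_subset[OF that H(2)] that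
  proof (induction K rule: finite_induct)
    case empty
    show ?case by (simp add: vanishes_zero)
  next
    case (insert g K)
    define p where "p = (\<Prod>g\<in>K. e \<circ> g)"
    have "p \<in> PF" unfolding p_def using eg insert.prems by (intro PF_prod) auto
    moreover have "vanishes N ((e - 1) \<circ> g) v"
      using e(2) H(1,3) insert.prems linear_groupD(3) by (intro vanishes_compose) auto
    ultimately have "vanishes N (((e - 1) \<circ> g) * p) v" by (intro vanishes_times)
    moreover have "vanishes N (p - 1) v" using insert.IH insert.prems unfolding p_def by blast
    ultimately have "vanishes N (((e - 1) \<circ> g) * p + (p - 1)) v" by (rule vanishes_add)
    moreover have "((e - 1) \<circ> g) * p + (p - 1) = (\<Prod>g\<in>insert g K. e \<circ> g) - 1"
      using insert.hyps by (simp add: p_def fun_eq_iff pointwise algebra_simps)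
    ultimately show ?case by (simp only:)
  qed
  then have E_v: "vanishes N (E - 1) v" by (simp add: E_def)
  define h' where "h' = (\<lambda>y. h (- v + y))"
  have hP: "h \<in> PF" "\<And>g x. g \<in> H \<Longrightarrow> h (g x) = h x"
    using h by (auto simp: invariant_ring_def H_def)
  have h': "h' \<in> PF" unfolding h'_def using hP(1) by (rule PF_translate)
  have h'_inv: "h' (g y) = h' y" if "g \<in> H" for g y
  proof -
    interpret g: Vector_Spaces.linear scale scale g using linear_groupD(3)[OF H(1) that] .
    have "- v + g y = g (- v + y)" using that H(3) by (simp add: g.diff)
    then show ?thesis using hP(2)[OF that] by (simp add: h'_def)
  qed
  define F where "F = E * h'"
  have F: "F \<in> PF" "\<And>g. g \<in> H \<Longrightarrow> F \<circ> g = F" "\<And>u. u \<in> S \<Longrightarrow> vanishes N F u"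
    using E h' by (auto simp: F_def PF_times fun_eq_iff pointwise E_inv h'_inv intro: vanishes_times E_S)
  \<comment> \<open>Summing over the set of distinct translates plays the role of a sum over cosets of \<open>H\<close>: the
    group permutes this set, \<open>F\<close> itself occurs once, and every other member comes from some
    \<open>g\<close> that moves \<open>v\<close> and so vanishes to order \<open>N\<close> at \<open>v\<close>.\<close>
  define M where "M = (\<lambda>g. F \<circ> g) ` G"
  define P where "P = (\<Sum>\<phi>\<in>M. \<phi>)"
  have M: "finite M" "M \<subseteq> PF"
    using G F(1) PF_compose linear_groupD(3) by (auto simp: M_def)
  have "P (k x) = P x" if k: "k \<in> G" for k x
  proof -
    have inj: "inj_on (\<lambda>\<phi>. \<phi> \<circ> k) M"
      using linear_groupD(4)[OF G(1) k] by (intro inj_onI) (metis bij_is_surj surjD comp_apply ext)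
    have "(\<lambda>\<phi>. \<phi> \<circ> k) ` M \<subseteq> M"
      using linear_groupD(2)[OF G(1) _ k] by (auto simp: M_def comp_assoc)
    then have img: "(\<lambda>\<phi>. \<phi> \<circ> k) ` M = M" using inj M(1) by (simp add: endo_inj_surj)
    have "P (k x) = (\<Sum>\<phi>\<in>M. (\<phi> \<circ> k) x)" by (simp add: P_def pointwise)
    also have "\<dots> = (\<Sum>\<phi>\<in>(\<lambda>\<phi>. \<phi> \<circ> k) ` M. \<phi> x)" by (simp add: sum.reindex[OF inj])
    finally show ?thesis by (simp add: img P_def pointwise)
  qed
  moreover have PP: "P \<in> PF" unfolding P_def using M(2) by (intro PF_sum) auto
  ultimately have "P \<in> invariant_ring scale G" by (simp add: invariant_ring_def)
  moreover have "component d (\<lambda>x. P (v + x)) = component d h" if "d < N" for d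
  proof -
    have "F \<in> M" unfolding M_def using linear_groupD(1)[OF G(1)] by (intro image_eqI[of _ _ id]) auto
    then have "P = F + (\<Sum>\<phi>\<in>M-{F}. \<phi>)" unfolding P_def using M(1) by (intro sum.remove)
    then have eq: "P - h' = (E - 1) * h' + (\<Sum>\<phi>\<in>M-{F}. \<phi>)"
      by (simp add: F_def algebra_simps)
    have "vanishes N \<phi> v" if \<phi>: "\<phi> \<in> M - {F}" for \<phi>
    proof -
      obtain g where g: "g \<in> G" "\<phi> = F \<circ> g" using \<phi> by (auto simp: M_def)
      then have "g v \<noteq> v" using F(2)[of g] H(3) \<phi> by auto
      then have "g v \<in> S" using g(1) by (auto simp: S_def)
      then show ?thesis unfolding g(2)
        using F(3) linear_groupD(3)[OF G(1) g(1)] by (intro vanishes_compose)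
    qed
    then have van: "vanishes N (P - h') v"
      unfolding eq using E_v h' by (intro vanishes_add vanishes_times vanishes_sum)
    have "(\<lambda>x. P (v + x)) = h + (\<lambda>x. (P - h') (v + x))"
      by (simp add: h'_def fun_eq_iff pointwise)
    moreover have "(\<lambda>x. (P - h') (v + x)) \<in> PF" using PP h' by (intro PF_translate PF_diff)
    ultimately have "component d (\<lambda>x. P (v + x)) = component d h + component d (\<lambda>x. (P - h') (v + x))"
      using hP(1) by (simp only: component_add)
    then show ?thesis using vanishes_component[OF van that] by simp
  qed
  ultimately show ?thesis by blast
qed

text \<open>
  Translation by \<open>v\<close> turns the \<open>n\<close> generators for \<open>G\<close> into \<open>n\<close> invariants of the stabilizer that
  generate its graded ring of invariants up to high order; so \<open>n\<close> homogeneous generators suffice.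
  They are independent because the untranslated generators for \<open>G\<close> are \<open>n\<close> independent elements
  of the same ring.
\<close>
lemma polynomial_ring_vector_stabilizer:
  assumes G: "linear_group G" "finite G" and poly: "polynomial_ring (invariant_ring scale G)"
  shows "polynomial_ring (invariant_ring scale (pointwise_stabilizer G {v}))"
proof -
  obtain B where B: "alg_independent B" "generated_algebra B = invariant_ring scale G"
    using poly unfolding polynomial_ring_def by blast
  have BG: "B \<subseteq> invariant_ring scale G" using B(2) generated_algebra.base by blast
  have finB: "finite B"
    using alg_independent_finite[OF finite_coordinates B(1)] BG invariant_ring_PF
    unfolding PF_eq_coordinates by blast
  define R where "R = invariant_ring scale (pointwise_stabilizer G {v})"
  have GR: "invariant_ring scale G \<subseteq> R"
    by (auto simp: R_def invariant_ring_def pointwise_stabilizer_def)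
  define \<tau> where "\<tau> f = (\<lambda>x. f (v + x))" for f :: "'v \<Rightarrow> 'k"
  have \<tau>R: "\<tau> f \<in> R" if "f \<in> invariant_ring scale G" for f
  proof -
    have "f (v + g x) = f (v + x)" if "g \<in> pointwise_stabilizer G {v}" for g x
    proof -
      have g: "g \<in> G" "g v = v" using that by (auto simp: pointwise_stabilizer_def)
      then have "v + g x = g (v + x)"
        using linear_groupD(3)[OF G(1) g(1)] by (simp add: linear_map_iff)
      then show ?thesis using \<open>f \<in> _\<close> g(1) by (simp add: invariant_ring_def)
    qed
    then show ?thesis
      using that PF_translate by (auto simp: R_def \<tau>_def invariant_ring_def)
  qed
  have \<tau>_gen: "\<tau> f \<in> generated_algebra (\<tau> ` B)" if "f \<in> generated_algebra B" for f
    using that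
    by induction (auto simp: \<tau>_def intro: generated_algebra.intros)
  have "\<exists>T\<subseteq>R. finite T \<and> card T \<le> card (\<tau> ` B) \<and> generated_algebra T = R"
  proof (rule graded_algebra_generators)
    show "R \<subseteq> PF" "generated_algebra R \<subseteq> R"
      using invariant_ring_PF generated_algebra_invariant_ring by (auto simp: R_def)
    show "component d f \<in> R" if "f \<in> R" for f d
      unfolding R_def
    proof (rule component_invariant)
      show "f \<in> invariant_ring scale (pointwise_stabilizer G {v})" using that by (simp add: R_def)
    qed (use linear_groupD(3)[OF G(1)] in \<open>auto simp: pointwise_stabilizer_def\<close>)
    show "finite (\<tau> ` B)" using finB by simp
    show "\<tau> ` B \<subseteq> R" using \<tau>R BG by blast
    fix h N assume "h \<in> R"
    then obtain P where "P \<in> generated_algebra B" "\<forall>d<N. component d (\<tau> P) = component d h"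
      using lift_local_invariant[OF G, of h v N] unfolding R_def B(2) \<tau>_def by blast
    then show "\<exists>P\<in>generated_algebra (\<tau> ` B). \<forall>d<N. component d P = component d h"
      using \<tau>_gen by blast
  qed
  then obtain T where T: "finite T" "card T \<le> card (\<tau> ` B)" "generated_algebra T = R" by blast
  have "card T \<le> card B" using T(2) card_image_le[OF finB, of \<tau>] by simp
  then have "alg_independent T"
    using alg_independent_generators[OF T(1) finB B(1)] T(3) BG GR by auto
  then show ?thesis using T(3) unfolding polynomial_ring_def R_def by blast
qed

text \<open>
  The stabilizer of a subspace is obtained by fixing the vectors of a basis one at a time.
\<close>
theorem polynomial_ring_stabilizer:
  assumes G: "linear_group G" "finite G" and poly: "polynomial_ring (invariant_ring scale G)"
  shows "polynomial_ring (invariant_ring scale (pointwise_stabilizer G W))"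
proof -
  have fin: "polynomial_ring (invariant_ring scale (pointwise_stabilizer G C))" if "finite C" for C
    using that
  proof (induction C rule: finite_induct)
    case empty
    show ?case using poly by (simp add: pointwise_stabilizer_def)
  next
    case (insert w C)
    have "pointwise_stabilizer G (insert w C) =
        pointwise_stabilizer (pointwise_stabilizer G C) {w}"
      by (auto simp: pointwise_stabilizer_def)
    moreover have "finite (pointwise_stabilizer G C)" using G(2) by (simp add: pointwise_stabilizer_def)
    ultimately show ?case
      using polynomial_ring_vector_stabilizer[OF linear_group_stabilizer[OF G(1)] _ insert.IH]
      by simp
  qed
  obtain C where C: "C \<subseteq> W" "independent C" "W \<subseteq> span C" using maximal_independent_subset by blast
  have "\<forall>w\<in>W. g w = w" if g: "g \<in> G" "\<forall>w\<in>C. g w = w" for g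
  proof -
    interpret g: Vector_Spaces.linear scale scale g using linear_groupD(3)[OF G(1) g(1)] .
    have "subspace {w. g w = w}" by (simp add: subspace_def g.add g.scale g.zero)
    then have "span C \<subseteq> {w. g w = w}" using g(2) by (intro span_minimal) auto
    then show ?thesis using C(3) by blast
  qed
  then have "pointwise_stabilizer G W = pointwise_stabilizer G C"
    using C(1) by (auto simp: pointwise_stabilizer_def)
  then show ?thesis using fin[OF finiteI_independent[OF C(2)]] by simp
qed

section \<open>Commuting pseudoreflections without common fixed vector\<close>

lemma group_GL: "group (GL scale)"
proof (rule groupI)
  fix g assume g: "g \<in> carrier (GL scale)"
  then have lin: "Vector_Spaces.linear scale scale g" and bij: "bij g" by (auto simp: GL_def)
  let ?h = "inv_into UNIV g"
  have h: "?h y = x \<longleftrightarrow> g x = y" for x y by (metis bij bij_inv_eq_iff)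
  have "g (?h y) = y" for y using h by blast
  then have "Vector_Spaces.linear scale scale ?h"
    using lin by (simp add: linear_map_iff h)
  moreover have "bij ?h" using bij by (rule bij_imp_bij_inv)
  moreover have "?h \<circ> g = id" using h by (auto simp: fun_eq_iff)
  ultimately show "\<exists>y\<in>carrier (GL scale). y \<otimes>\<^bsub>GL scale\<^esub> g = \<one>\<^bsub>GL scale\<^esub>"
    by (intro bexI[of _ ?h]) (auto simp: GL_def)
qed (auto simp: GL_def linear_map_iff bij_comp comp_assoc)

lemma GL_inv:
  assumes "g \<in> carrier (GL scale)"
  shows "inv\<^bsub>GL scale\<^esub> g = inv_into UNIV g" "g (inv_into UNIV g v) = v" "inv_into UNIV g (g v) = v"
proof -
  interpret group "GL scale" by (rule group_GL)
  have bij: "bij g" using assms by (auto simp: GL_def)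
  show "g (inv_into UNIV g v) = v" "inv_into UNIV g (g v) = v" for v
    using bij by (auto simp: bij_is_surj bij_is_inj surj_f_inv_f)
  have "(inv\<^bsub>GL scale\<^esub> g) \<circ> g = id" using l_inv[OF assms] by (simp add: GL_def)
  then have "(inv\<^bsub>GL scale\<^esub> g) (g v) = v" for v by (metis comp_apply id_apply)
  then show "inv\<^bsub>GL scale\<^esub> g = inv_into UNIV g"
    using bij by (metis bij_inv_eq_iff ext)
qed

lemma linear_group_if_subgroup:
  assumes "subgroup G (GL scale)"
  shows "linear_group G"
proof -
  interpret subgroup G "GL scale" by fact
  show ?thesis
    unfolding linear_group_def
  proof (intro conjI ballI)
    show "id \<in> G" using one_closed by (simp add: GL_def)
    fix g assume g: "g \<in> G"
    then have c: "g \<in> carrier (GL scale)" by (rule mem_carrier)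
    then show "Vector_Spaces.linear scale scale g" "bij g" by (auto simp: GL_def)
    show "inv_into UNIV g \<in> G" using m_inv_closed[OF g] GL_inv(1)[OF c] by simp
    show "g \<circ> h \<in> G" if "h \<in> G" for h using m_closed[OF g that] by (simp add: GL_def)
  qed
qed

lemma generate_fixes:
  assumes "g \<in> generate (GL scale) S" "S \<subseteq> carrier (GL scale)" "\<And>s. s \<in> S \<Longrightarrow> s v = v"
  shows "g v = v"
  using assms(1)
proof induction
  case one
  then show ?case by (simp add: GL_def)
next
  case (incl h)
  then show ?case by (rule assms(3))
next
  case (inv h)
  then show ?case using GL_inv(1)[of h] GL_inv(3)[of h v] assms(2,3) by (metis subsetD)
next
  case (eng h k)
  then show ?case by (simp add: GL_def)
qed

lemma generate_preserves:
  assumes "g \<in> generate (GL scale) S" "S \<subseteq> carrier (GL scale)"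
    and "\<And>s v. s \<in> S \<Longrightarrow> F (s v) = F v"
  shows "F (g v) = F v"
  using assms(1)
proof (induction arbitrary: v)
  case one
  then show ?case by (simp add: GL_def)
next
  case (incl h)
  then show ?case by (rule assms(3))
next
  case (inv h)
  then show ?case using GL_inv(1)[of h] GL_inv(2)[of h v] assms(2,3) by (metis subsetD)
next
  case (eng h k)
  then show ?case by (simp add: GL_def)
qed

text \<open>
  Take \<open>u\<close> outside the fixed hyperplane, \<open>b = r u - u\<close>, and \<open>f v\<close> the coefficient of \<open>u\<close> in \<open>v\<close> modulo
  the hyperplane.
\<close>
lemma pseudoreflection_form:
  assumes "pseudoreflection scale r"
  shows "\<exists>f b. Vector_Spaces.linear scale (*) f \<and> b \<noteq> 0 \<and> (\<exists>u. f u \<noteq> 0) \<and>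
    (\<forall>v. r v = v + scale (f v) b)"
proof -
  interpret r: Vector_Spaces.linear scale scale r
    using assms by (simp add: pseudoreflection_def)
  define H where "H = fixed_points r"
  have H: "subspace H" "dim H + 1 = dim UNIV"
    using assms by (auto simp: pseudoreflection_def hyperplane_def H_def)
  have "H \<noteq> UNIV" using H(2) by auto
  then obtain u where u: "u \<notin> H" by blast
  have spanH: "span H = H" using H(1) by (simp add: span_eq_iff)
  have "u \<notin> span H" using u unfolding spanH .
  then have "dim (insert u H) = dim UNIV" using H(2) by (simp add: dim_insert)
  then have "span (insert u H) = UNIV" using dim_eq_full[of "insert u H"] by (simp add: dimension_def)
  then have ex: "\<exists>k. v - scale k u \<in> H" for v
    using span_breakdown_eq[of v u H] spanH by auto
  have uniq: "k = l" if "v - scale k u \<in> H" "v - scale l u \<in> H" for k l v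
  proof (rule ccontr)
    assume "k \<noteq> l"
    have "(v - scale l u) - (v - scale k u) \<in> H" by (rule subspace_diff[OF H(1) that(2,1)])
    then have "scale (k - l) u \<in> H" by (simp add: scale_left_diff_distrib)
    then have "scale (inverse (k - l)) (scale (k - l) u) \<in> H" by (rule subspace_scale[OF H(1)])
    then show False using u \<open>k \<noteq> l\<close> by simp
  qed
  define f where "f v = (SOME k. v - scale k u \<in> H)" for v
  have f: "v - scale (f v) u \<in> H" for v unfolding f_def using ex by (rule someI_ex)
  have f_eqI: "f v = k" if "v - scale k u \<in> H" for v k using uniq f that by blast
  have "f (v + w) = f v + f w" for v w
    using subspace_add[OF H(1) f[of v] f[of w]]
    by (intro f_eqI) (simp add: algebra_simps scale_left_distrib)
  moreover have "f (scale c v) = c * f v" for c v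
    using subspace_scale[OF H(1) f[of v], of c]
    by (intro f_eqI) (simp add: scale_right_diff_distrib)
  ultimately have "Vector_Spaces.linear scale (*) f" by (simp add: linear_form_iff)
  moreover have "f u = 1" using subspace_0[OF H(1)] by (intro f_eqI) simp
  then have "f u \<noteq> 0" by simp
  moreover have "r u - u \<noteq> 0" using u by (simp add: H_def fixed_points_def)
  moreover have "r v = v + scale (f v) (r u - u)" for v
  proof -
    have "r (v - scale (f v) u) = v - scale (f v) u"
      using f[of v] by (simp add: H_def fixed_points_def)
    then show ?thesis by (simp add: r.diff r.scale scale_right_diff_distrib algebra_simps)
  qed
  ultimately show ?thesis using \<open>f u \<noteq> 0\<close> by blast
qed

text \<open>
  Choosing one pseudoreflection for each reflecting hyperplane yields linear forms \<open>f r\<close> and vectors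
  \<open>b r\<close> that are dual to each other up to nonzero factors. In these coordinates each
  pseudoreflection multiplies one coordinate by a root of unity and leaves the others alone. So a
  monomial is invariant exactly if the exponent of each coordinate is a multiple of its
  least positive invariant exponent, and the invariants are the polynomials in the corresponding powers.
\<close>
lemma polynomial_ring_if_no_fixed_vector:
  assumes G: "linear_group G" "finite G"
    and S: "S \<subseteq> G" "\<And>s. s \<in> S \<Longrightarrow> pseudoreflection scale s" "generate (GL scale) S = G"
    and comm: "\<And>g h. g \<in> G \<Longrightarrow> h \<in> G \<Longrightarrow> g \<circ> h = h \<circ> g"
    and nofix: "\<And>v. (\<And>g. g \<in> G \<Longrightarrow> g v = v) \<Longrightarrow> v = 0"
    and roots: "\<And>n (x :: 'k). n > 0 \<Longrightarrow> \<exists>y. y ^ n = x"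
  shows "polynomial_ring (invariant_ring scale G)"
proof -
  have SGL: "S \<subseteq> carrier (GL scale)"
    using S(1) linear_groupD(3,4)[OF G(1)] by (auto simp: GL_def)
  have "\<exists>f b. s \<in> S \<longrightarrow> Vector_Spaces.linear scale (*) f \<and> b \<noteq> 0 \<and> (\<exists>u. f u \<noteq> 0) \<and>
    (\<forall>v. s v = v + scale (f v) b)" for s
    using pseudoreflection_form[OF S(2)] by blast
  then obtain f b where fb: "\<And>s. s \<in> S \<Longrightarrow> Vector_Spaces.linear scale (*) (f s)"
    "\<And>s. s \<in> S \<Longrightarrow> b s \<noteq> 0" "\<And>s. s \<in> S \<Longrightarrow> \<exists>u. f s u \<noteq> 0"
    "\<And>s v. s \<in> S \<Longrightarrow> s v = v + scale (f s v) (b s)"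
    by metis
  have f_lin: "f s (u + v) = f s u + f s v" "f s (scale c v) = c * f s v" if "s \<in> S" for s u v c
    using fb(1)[OF that] by (auto simp: linear_form_iff)
  have f_sum: "f s (\<Sum>i\<in>I. scale (c i) (w i)) = (\<Sum>i\<in>I. c i * f s (w i))"
    if "s \<in> S" for s c w and I :: "('v \<Rightarrow> 'v) set"
  proof -
    interpret f: Vector_Spaces.linear scale "(*)" "f s" by (rule fb(1)[OF that])
    show ?thesis by (simp add: f.sum f.scale)
  qed
  have f_diff: "f s (u - v) = f s u - f s v" if "s \<in> S" for s u v
    using f_lin(1)[OF that, of "u - v" v] by simp
  have common_zero: "v = 0" if "\<And>s. s \<in> S \<Longrightarrow> f s v = 0" for v
  proof (rule nofix)
    fix g assume "g \<in> G"
    moreover have "s v = v" if "s \<in> S" for s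
      by (subst fb(4)[OF that]) (simp add: \<open>\<And>s. s \<in> S \<Longrightarrow> f s v = 0\<close>[OF that])
    ultimately show "g v = v"
      using S(3) SGL by (intro generate_fixes[of g S]) auto
  qed
  \<comment> \<open>Both products of \<open>r\<close> and \<open>s\<close> share all terms except these.\<close>
  have commute: "scale (f r (b s) * f s v) (b r) = scale (f s (b r) * f r v) (b s)"
    if "r \<in> S" "s \<in> S" for r s v
  proof -
    have "r (s v) = s (r v)"
      using comm[of r s] that S(1) by (metis comp_apply subsetD)
    moreover have "r (s v) = v + scale (f s v) (b s) + scale (f r v) (b r) +
        scale (f r (b s) * f s v) (b r)"
      using that by (simp add: fb(4)[OF that(1)] fb(4)[OF that(2)] f_lin scale_left_distrib mult.commute add.assoc)
    moreover have "s (r v) = v + scale (f s v) (b s) + scale (f r v) (b r) +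
        scale (f s (b r) * f r v) (b s)"
      using that by (simp add: fb(4)[OF that(1)] fb(4)[OF that(2)] f_lin scale_left_distrib mult.commute add_ac)
    ultimately show ?thesis by simp
  qed
  define K where "K s = {v. f s v = 0}" for s
  \<comment> \<open>If the right-hand side of \<open>commute\<close> is not identically zero, neither is the left-hand side, and
    their zero sets are the two hyperplanes.\<close>
  have same_K: "K r = K s" if "r \<in> S" "s \<in> S" "f s (b r) \<noteq> 0" for r s
  proof -
    have 1: "f r v = 0" if "f s v = 0" for v
      using commute[OF \<open>r \<in> S\<close> \<open>s \<in> S\<close>, of v] that \<open>f s (b r) \<noteq> 0\<close> fb(2)[OF \<open>s \<in> S\<close>] by simp
    obtain u where "f r u \<noteq> 0" using fb(3)[OF \<open>r \<in> S\<close>] by blast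
    then have "f r (b s) \<noteq> 0"
      using commute[OF that(1,2), of u] that(3) fb(2)[OF that(2)] by auto
    then have "f s v = 0" if "f r v = 0" for v
      using commute[OF \<open>r \<in> S\<close> \<open>s \<in> S\<close>, of v] that fb(2)[OF \<open>r \<in> S\<close>] by simp
    with 1 show ?thesis by (auto simp: K_def)
  qed
  \<comment> \<open>No transvections: some \<open>s\<close> moves \<open>b r\<close>, so \<open>r\<close> and \<open>s\<close> share their hyperplane, and
    \<open>b r\<close> is not on it.\<close>
  have diag: "f r (b r) \<noteq> 0" if r: "r \<in> S" for r
  proof -
    obtain s where s: "s \<in> S" "f s (b r) \<noteq> 0" using common_zero[of "b r"] fb(2)[OF r] by blast
    then have "b r \<notin> K r" using same_K[OF r s] by (simp add: K_def)
    then show ?thesis by (simp add: K_def)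
  qed
  obtain S' where S': "S' \<subseteq> S" "inj_on K S'" "K ` S = K ` S'"
    using subset_image_inj[of "K ` S" K S] by auto
  have finS': "finite S'" using S'(1) S(1) G(2) by (meson finite_subset)
  have S'S: "r \<in> S" if "r \<in> S'" for r using that S'(1) by blast
  have off_diag: "f s (b r) = 0" if "r \<in> S" "s \<in> S" "K r \<noteq> K s" for r s
    using same_K that by blast
  have f_comb: "f q (\<Sum>r\<in>S'. scale (x r / f r (b r)) (b r)) = x q" if q: "q \<in> S'" for x q
  proof -
    have "f q (\<Sum>r\<in>S'. scale (x r / f r (b r)) (b r)) = (\<Sum>r\<in>S'. x r / f r (b r) * f q (b r))"
      using q S'S by (intro f_sum) auto
    also have "\<dots> = (\<Sum>r\<in>S'. if r = q then x q else 0)"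
    proof (rule sum.cong)
      fix r assume r: "r \<in> S'"
      show "x r / f r (b r) * f q (b r) = (if r = q then x q else 0)"
        using diag[OF S'S[OF r]] off_diag[OF S'S[OF r] S'S[OF q]] inj_onD[OF S'(2) _ r q] by auto
    qed simp
    also have "\<dots> = x q" using q finS' by simp
    finally show ?thesis .
  qed
  have expand: "v = (\<Sum>r\<in>S'. scale (f r v / f r (b r)) (b r))" for v
  proof -
    define w where "w = v - (\<Sum>r\<in>S'. scale (f r v / f r (b r)) (b r))"
    have w': "f q w = 0" if "q \<in> S'" for q
      using f_comb[OF that, of "\<lambda>r. f r v"] f_diff[OF S'S[OF that]] by (simp add: w_def)
    have "f s w = 0" if "s \<in> S" for s
    proof -
      obtain q where "q \<in> S'" "K s = K q" using S'(3) \<open>s \<in> S\<close> by blast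
      then show ?thesis using w' by (auto simp: K_def)
    qed
    then show ?thesis using common_zero[of w] by (simp add: w_def)
  qed
  have inj_f: "inj_on f S'" using S'(2) by (auto simp: inj_on_def K_def)
  define \<Phi> where "\<Phi> = f ` S'"
  have fin\<Phi>: "finite \<Phi>" using finS' by (simp add: \<Phi>_def)
  have \<Phi>_PF: "generated_algebra \<Phi> = PF"
  proof
    show "generated_algebra \<Phi> \<subseteq> PF"
      using fb(1) S'S PF_linear by (intro generated_algebra_PF) (auto simp: \<Phi>_def)
    have "l \<in> generated_algebra \<Phi>" if "Vector_Spaces.linear scale (*) l" for l
    proof -
      interpret l: Vector_Spaces.linear scale "(*)" l by fact
      have "l = (\<Sum>r\<in>S'. fscale (l (b r) / f r (b r)) (f r))"
      proof
        fix v
        have "l v = (\<Sum>r\<in>S'. f r v / f r (b r) * l (b r))"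
          by (subst expand[of v]) (simp add: l.sum l.scale)
        also have "\<dots> = (\<Sum>r\<in>S'. fscale (l (b r) / f r (b r)) (f r)) v"
          by (simp add: pointwise algebra_simps)
        finally show "l v = (\<Sum>r\<in>S'. fscale (l (b r) / f r (b r)) (f r)) v" .
      qed
      also have "\<dots> \<in> generated_algebra \<Phi>"
        by (intro generated_algebra_sum generated_algebra_fscale generated_algebra.base)
          (auto simp: \<Phi>_def)
      finally show ?thesis .
    qed
    then show "PF \<subseteq> generated_algebra \<Phi>"
      unfolding polynomial_functions_def by (intro generated_algebra_subset) auto
  qed
  \<comment> \<open>The factor by which \<open>s\<close> multiplies the coordinate \<open>f r\<close>; it is \<open>1\<close> unless \<open>r\<close> represents the
    hyperplane of \<open>s\<close>.\<close>
  define \<zeta> where "\<zeta> s r = (if K r = K s then 1 + f s (b r) * f r (b s) / f r (b r) else 1)" for s r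
  have act: "f r (s v) = \<zeta> s r * f r v" if s: "s \<in> S" and r: "r \<in> S'" for s r v
  proof (cases "K r = K s")
    case False
    then show ?thesis
      using off_diag[OF s S'S[OF r]] by (simp add: fb(4)[OF s] f_lin[OF S'S[OF r]] \<zeta>_def)
  next
    case True
    have "f r (v - scale (f r v / f r (b r)) (b r)) = 0"
      using diag[OF S'S[OF r]] by (simp add: f_diff f_lin S'S[OF r])
    then have "f s (v - scale (f r v / f r (b r)) (b r)) = 0" using True by (auto simp: K_def)
    then have "f s v = f r v / f r (b r) * f s (b r)" by (simp add: f_diff f_lin s)
    then show ?thesis using True
      by (simp add: fb(4)[OF s, of v] f_lin[OF S'S[OF r]] \<zeta>_def algebra_simps)
  qed
  have "\<exists>n>0. \<forall>s\<in>S. \<zeta> s r ^ n = 1" if r: "r \<in> S'" for r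
  proof -
    have "\<exists>n>0. \<zeta> s r ^ n = 1" if s: "s \<in> S" for s
    proof -
      obtain n where n: "n > 0" "s ^^ n = id" using S(2)[OF s] by (auto simp: pseudoreflection_def)
      have "f r ((s ^^ m) (b r)) = \<zeta> s r ^ m * f r (b r)" for m
        by (induction m) (simp_all add: act[OF s r])
      from this[of n] have "\<zeta> s r ^ n = 1" using n(2) diag[OF S'S[OF r]] by simp
      then show ?thesis using n(1) by blast
    qed
    then obtain n where n: "\<And>s. s \<in> S \<Longrightarrow> n s > 0 \<and> \<zeta> s r ^ n s = 1" by metis
    have finS: "finite S" using S(1) G(2) by (rule finite_subset)
    have "\<zeta> s r ^ (\<Prod>s\<in>S. n s) = 1" if "s \<in> S" for s
    proof -
      have "(\<Prod>s\<in>S. n s) = n s * (\<Prod>s\<in>S-{s}. n s)" using finS that by (rule prod.remove)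
      then show ?thesis using n[OF that] by (simp add: power_mult)
    qed
    moreover have "(\<Prod>s\<in>S. n s) > 0" using n by (intro prod_pos) auto
    ultimately show ?thesis by blast
  qed
  note period = this
  define e where "e r = (LEAST n. n > 0 \<and> (\<forall>s\<in>S. \<zeta> s r ^ n = 1))" for r
  have e: "e r > 0" "\<And>s. s \<in> S \<Longrightarrow> \<zeta> s r ^ e r = 1" if "r \<in> S'" for r
    using LeastI_ex[of "\<lambda>n. n > 0 \<and> (\<forall>s\<in>S. \<zeta> s r ^ n = 1)"] period[OF that]
    unfolding e_def by blast+
  have e_dvd: "e r dvd a" if r: "r \<in> S'" and a: "\<And>s. s \<in> S \<Longrightarrow> \<zeta> s r ^ a = 1" for r a
  proof (rule ccontr)
    assume "\<not> e r dvd a"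
    then have pos: "a mod e r > 0" by (simp add: dvd_eq_mod_eq_0)
    have "\<zeta> s r ^ (a mod e r) = 1" if s: "s \<in> S" for s
    proof -
      have "\<zeta> s r ^ a = \<zeta> s r ^ (e r * (a div e r) + a mod e r)" by simp
      also have "\<dots> = \<zeta> s r ^ (a mod e r)"
        using e(2)[OF r s] by (simp only: power_add power_mult power_one mult_1_left)
      finally show ?thesis using a[OF s] by simp
    qed
    with pos have "(LEAST n. n > 0 \<and> (\<forall>s\<in>S. \<zeta> s r ^ n = 1)) \<le> a mod e r"
      by (intro Least_le) blast
    then have "e r \<le> a mod e r" by (simp only: e_def[of r])
    then show False using mod_less_divisor[OF e(1)[OF r], of a] by linarith
  qed
  define B where "B = (\<lambda>r. f r ^ e r) ` S'"
  have finB: "finite B" using finS' by (simp add: B_def)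
  have surj: "\<exists>v. \<forall>r\<in>S'. f r v = x r" for x
    using f_comb by blast
  have ind\<Phi>: "alg_independent \<Phi>"
  proof (rule alg_independent_if_surjective[OF infinite_scalars fin\<Phi>])
    fix x :: "('v \<Rightarrow> 'k) \<Rightarrow> 'k"
    show "\<exists>v. \<forall>\<phi>\<in>\<Phi>. \<phi> v = x \<phi>" using surj[of "\<lambda>r. x (f r)"] by (auto simp: \<Phi>_def)
  qed
  \<comment> \<open>The powers still take all tuples of values, because roots exist in the field.\<close>
  have indB: "alg_independent B"
  proof (rule alg_independent_if_surjective[OF infinite_scalars finB])
    fix x :: "('v \<Rightarrow> 'k) \<Rightarrow> 'k"
    have "\<forall>r\<in>S'. \<exists>y. y ^ e r = x (f r ^ e r)" using roots e(1) by blast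
    then obtain y where y: "\<And>r. r \<in> S' \<Longrightarrow> y r ^ e r = x (f r ^ e r)" by metis
    obtain v where "\<forall>r\<in>S'. f r v = y r" using surj by blast
    then show "\<exists>v. \<forall>b\<in>B. b v = x b" using y by (intro exI[of _ v]) (auto simp: B_def pointwise)
  qed
  have power_product_\<Phi>: "power_product \<Phi> a = (\<Prod>r\<in>S'. f r ^ a (f r))" for a
    unfolding power_product_def \<Phi>_def using prod.reindex[OF inj_f, of "\<lambda>t. t ^ a t"] by simp
  have "h \<in> generated_algebra B" if h: "h \<in> invariant_ring scale G" for h
  proof -
    have "h \<in> generated_algebra \<Phi>" using h invariant_ring_PF \<Phi>_PF by blast
    then obtain E where "h \<in> fs.span (bounded_monomials (\<lambda>_. 1) \<Phi> E)"
      using generated_algebra_bounded[OF fin\<Phi>] by blast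
    then obtain t c where t: "finite t" "t \<subseteq> bounded_monomials (\<lambda>_. 1) \<Phi> E"
      "h = (\<Sum>m\<in>t. fscale (c m) m)"
      unfolding fs.span_explicit by blast
    then obtain A where A: "A \<subseteq> exponents \<Phi>" "inj_on (power_product \<Phi>) A" "t = power_product \<Phi> ` A"
      unfolding bounded_monomials_def subset_image_inj by blast
    have finA: "finite A" using t(1) A(2,3) by (simp add: finite_image_iff)
    define d where "d a = c (power_product \<Phi> a)" for a
    have h_eq: "h = (\<Sum>a\<in>A. fscale (d a) (power_product \<Phi> a))"
      unfolding t(3) A(3) d_def by (simp add: sum.reindex[OF A(2)])
    have "fscale (d a) (power_product \<Phi> a) \<in> generated_algebra B" if a: "a \<in> A" for a
    proof (cases "d a = 0")
      case True
      then show ?thesis using generated_algebra_zero[of B] by simp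
    next
      case False
      define z where "z s a = (\<Prod>r\<in>S'. \<zeta> s r ^ a (f r))" for s and a :: "('v \<Rightarrow> 'k) \<Rightarrow> nat"
      have z1: "z s a = 1" if s: "s \<in> S" for s
      proof -
        have mon_s: "power_product \<Phi> a (s v) = z s a * power_product \<Phi> a v" for a v
          unfolding power_product_\<Phi> z_def using act[OF s]
          by (simp add: pointwise power_mult_distrib prod.distrib)
        \<comment> \<open>Monomials are eigenvectors of \<open>s\<close>, so comparing coefficients in \<open>h (s v) = h v\<close> shows that
          every monomial occurring in \<open>h\<close> is fixed by \<open>s\<close>.\<close>
        have "(\<Sum>a\<in>A. fscale (d a * (z s a - 1)) (power_product \<Phi> a)) v = 0" for v
        proof -
          have "s \<in> G" using s S(1) by blast
          then have "h (s v) = h v" using h by (simp add: invariant_ring_def)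
          then show ?thesis
            unfolding h_eq by (simp add: pointwise mon_s algebra_simps sum_subtractf)
        qed
        then have "(\<Sum>a\<in>A. fscale (d a * (z s a - 1)) (power_product \<Phi> a)) = 0"
          by (simp add: fun_eq_iff pointwise)
        then have "d a * (z s a - 1) = 0"
          using ind\<Phi>[unfolded alg_independent_iff[OF fin\<Phi>], rule_format, of A "\<lambda>a. d a * (z s a - 1)" a]
            finA A(1) a by blast
        then show ?thesis using False by simp
      qed
      have "e r dvd a (f r)" if r: "r \<in> S'" for r
      proof (rule e_dvd[OF r])
        fix s assume s: "s \<in> S"
        show "\<zeta> s r ^ a (f r) = 1"
        proof (cases "K r = K s")
          case True
          have "z s a = \<zeta> s r ^ a (f r) * (\<Prod>q\<in>S'-{r}. \<zeta> s q ^ a (f q))"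
            unfolding z_def using finS' r by (rule prod.remove)
          also have "(\<Prod>q\<in>S'-{r}. \<zeta> s q ^ a (f q)) = 1"
          proof (rule prod.neutral, rule ballI)
            fix q assume q: "q \<in> S' - {r}"
            then have "K q \<noteq> K s" using inj_onD[OF S'(2), of q r] r True by auto
            then show "\<zeta> s q ^ a (f q) = 1" by (simp add: \<zeta>_def)
          qed
          finally show ?thesis using z1[OF s] by simp
        qed (simp add: \<zeta>_def)
      qed
      then have "f r ^ a (f r) = (f r ^ e r) ^ (a (f r) div e r)" if "r \<in> S'" for r
        using that by (simp flip: power_mult)
      then have "power_product \<Phi> a = (\<Prod>r\<in>S'. (f r ^ e r) ^ (a (f r) div e r))"
        unfolding power_product_\<Phi> by (intro prod.cong) auto
      also have "\<dots> \<in> generated_algebra B"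
        by (intro generated_algebra_prod generated_algebra_power generated_algebra.base)
          (auto simp: B_def)
      finally show ?thesis by (rule generated_algebra_fscale)
    qed
    then show ?thesis unfolding h_eq by (intro generated_algebra_sum)
  qed
  moreover have "B \<subseteq> invariant_ring scale G"
  proof
    fix \<beta> assume "\<beta> \<in> B"
    then obtain r where r: "r \<in> S'" "\<beta> = f r ^ e r" by (auto simp: B_def)
    have "\<beta> (s v) = \<beta> v" if "s \<in> S" for s v
      using act[OF that r(1)] e(2)[OF r(1) that] by (simp add: r(2) pointwise power_mult_distrib)
    then have "\<beta> (g v) = \<beta> v" if "g \<in> G" for g v
      using that S(3) SGL by (intro generate_preserves[of g S]) auto
    moreover have "\<beta> \<in> PF" unfolding r(2) using fb(1) S'S[OF r(1)] by (intro PF_power PF_linear)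
    ultimately show "\<beta> \<in> invariant_ring scale G" by (simp add: invariant_ring_def)
  qed
  then have "generated_algebra B \<subseteq> invariant_ring scale G"
    using generated_algebra_subset[of B "invariant_ring scale G"] generated_algebra_invariant_ring
    by simp
  ultimately have "generated_algebra B = invariant_ring scale G" by blast
  then show ?thesis using indB unfolding polynomial_ring_def by blast
qed

end

section \<open>Polynomial invariants and pointwise stabilizers\<close>

theorem corollary3p2:
  fixes scale :: "'k::alg_closed_field \<Rightarrow> 'v::ab_group_add \<Rightarrow> 'v"
    and Basis :: "'v set"
    and G :: "('v \<Rightarrow> 'v) set"
  assumes "finite_dimensional_vector_space scale Basis"
    and "subgroup G (GL scale)"
    and "finite G"
    and "comm_group (GL scale\<lparr>carrier := G\<rparr>)"
    and "generate (GL scale) {g \<in> G. pseudoreflection scale g} = G"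
  shows "polynomial_ring (invariant_ring scale G) \<longleftrightarrow>
    (\<forall>W. module.subspace scale W \<and> W \<noteq> {0} \<longrightarrow>
       polynomial_ring (invariant_ring scale (pointwise_stabilizer G W)))"
proof -
  interpret infinite_field_vector_space scale Basis
    using assms(1) infinite_UNIV_alg_closed
    by (simp add: infinite_field_vector_space_def infinite_field_vector_space_axioms_def)
  have G: "linear_group G" using assms(2) by (rule linear_group_if_subgroup)
  have comm: "g \<circ> h = h \<circ> g" if "g \<in> G" "h \<in> G" for g h
  proof -
    interpret comm_group "GL scale\<lparr>carrier := G\<rparr>" by fact
    show ?thesis using m_comm[of g h] that by (simp add: GL_def)
  qed
  show ?thesis
  proof
    assume "polynomial_ring (invariant_ring scale G)"
    then show "\<forall>W. subspace W \<and> W \<noteq> {0} \<longrightarrow>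
        polynomial_ring (invariant_ring scale (pointwise_stabilizer G W))"
      using polynomial_ring_stabilizer[OF G assms(3)] by blast
  next
    assume stab: "\<forall>W. subspace W \<and> W \<noteq> {0} \<longrightarrow>
        polynomial_ring (invariant_ring scale (pointwise_stabilizer G W))"
    define V where "V = {v. \<forall>g\<in>G. g v = v}"
    have "subspace V"
      unfolding subspace_def V_def
    proof (intro conjI ballI allI CollectI)
      fix g assume "g \<in> G"
      then interpret g: Vector_Spaces.linear scale scale g by (rule linear_groupD(3)[OF G])
      show "g 0 = 0" by (rule g.zero)
      fix x assume x: "x \<in> {v. \<forall>g\<in>G. g v = v}"
      show "g (scale c x) = scale c x" for c using x \<open>g \<in> G\<close> g.scale[of c x] by auto
      show "g (x + y) = x + y" if "y \<in> {v. \<forall>g\<in>G. g v = v}" for y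
        using x that \<open>g \<in> G\<close> g.add[of x y] by auto
    qed
    show "polynomial_ring (invariant_ring scale G)"
    proof (cases "V = {0}")
      case False
      have "pointwise_stabilizer G V = G" by (auto simp: pointwise_stabilizer_def V_def)
      then show ?thesis using stab \<open>subspace V\<close> False by metis
    next
      case True
      show ?thesis
      proof (rule polynomial_ring_if_no_fixed_vector[OF G assms(3) _ _ assms(5) comm])
        show "v = 0" if "\<And>g. g \<in> G \<Longrightarrow> g v = v" for v using that True by (auto simp: V_def)
        show "\<exists>y. y ^ n = x" if "n > 0" for n and x :: 'k using nth_root_exists[OF that] by blast
      qed auto
    qed
  qed
qed

end
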